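(* Let $R$ be a local domain with $\dim(R)\ge 2$. Then integral closure is not a Dietz closure on $R$.
   Context: Local rings are commutative Noetherian. A closure operation $\mathrm{cl}$ on a ring $R$ assigns to each pair $N\subseteq M$ of finitely generated $R$-modules a submodule $N_M^{\mathrm{cl}}$ of $M$ such that, for $N\subseteq N'\subseteq M$: $N\subseteq N_M^{\mathrm{cl}}$; $(N_M^{\mathrm{cl}})_M^{\mathrm{cl}}=N_M^{\mathrm{cl}}$; $N_M^{\mathrm{cl}}\subseteq (N')_M^{\mathrm{cl}}$. A closure operation $\mathrm{cl}$ on a local domain $(R,m)$ is a Dietz closure if, for all finitely generated $R$-modules $N\subseteq M$ and $W$: (1) (Functoriality) for every homomorphism $f:M\to W$, $f(N_M^{\mathrm{cl}})\subseteq f(N)_W^{\mathrm{cl}}$; (2) (Semi-residuality) if $N_M^{\mathrm{cl}}=N$ then $0_{M/N}^{\mathrm{cl}}=0$; (3) (Faithfulness) $m_R^{\mathrm{cl}}=m$; (4) (Generalized Colon-Capturing) if $x_1,\ldots,x_{k+1}$ is a partial system of parameters for $R$, $J=(x_1,\ldots,x_k)$, $f:M\to R/J$ is a surjective homomorphism and $v\in M$ satisfies $f(v)=x_{k+1}+J$, then $(Rv)_M^{\mathrm{cl}}\cap\ker f\subseteq (Jv)_M^{\mathrm{cl}}$. Integral closure: for an ideal $I$ of $R$, the integral closure $\overline{I}$ is the set of $r\in R$ satisfying an equation $r^n+a_1r^{n-1}+\cdots+a_n=0$ with $a_i\in I^i$. There are several ways to extend integral closure to modules; one is liftable integral closure,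 defined as follows. For a submodule $G$ of a finitely generated free module $R^s$, let $S$ be the symmetric algebra of $R^s$ over $R$ and $T$ the subring of $S$ induced by the inclusion $G\subseteq R^s$ (that is, generated over $R$ by $G$ in degree 1); the integral closure of $G$ in $R^s$ is the degree 1 part of the integral closure of $T$ in $S$. For finitely generated modules $N\subseteq M$, take a surjection $\pi:R^s\to M$; the closure of $N$ in $M$ is the image under $\pi$ of the integral closure of $\pi^{-1}(N)$ in $R^s$. For an ideal $I\subseteq R$ this gives $\overline{I}$. *)

theory Defs
  imports "HOL-Algebra.Algebra" "HOL-Library.Extended_Nat"
begin

section \<open>Local domains, dimension, parameters\<close>

definition local_domain :: "('a, 'm) ring_scheme \<Rightarrow> bool" where
  "local_domain R \<longleftrightarrow> noetherian_domain R \<and> (\<exists>!P. maximalideal P R)"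

definition max_ideal :: "('a, 'm) ring_scheme \<Rightarrow> 'a set" where
  "max_ideal R = (THE P. maximalideal P R)"

definition krull_dim :: "('a, 'm) ring_scheme \<Rightarrow> enat" where
  "krull_dim R = Sup (enat ` {n. \<exists>P. (\<forall>i\<le>n. primeideal (P i) R) \<and> (\<forall>i<n. P i \<subset> P (Suc i))})"

definition radical :: "('a, 'm) ring_scheme \<Rightarrow> 'a set \<Rightarrow> 'a set" where
  "radical R I = {r \<in> carrier R. \<exists>n::nat. r [^]\<^bsub>R\<^esub> n \<in> I}"

text \<open>A system of parameters is a list of \<open>dim R\<close> elements generating an ideal that is primary to
  the maximal ideal; as the maximal ideal is maximal, this says that its radical is the maximal
  ideal.\<close>

definition system_of_parameters :: "('a, 'm) ring_scheme \<Rightarrow> 'a list \<Rightarrow> bool" where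
  "system_of_parameters R xs \<longleftrightarrow>
     set xs \<subseteq> carrier R \<and> enat (length xs) = krull_dim R \<and>
     radical R (genideal R (set xs)) = max_ideal R"

definition partial_system_of_parameters :: "('a, 'm) ring_scheme \<Rightarrow> 'a list \<Rightarrow> bool" where
  "partial_system_of_parameters R xs \<longleftrightarrow> (\<exists>ys. system_of_parameters R (xs @ ys))"


section \<open>Finitely generated modules\<close>

definition fg_module :: "('a, 'm) ring_scheme \<Rightarrow> ('a, 'b) module \<Rightarrow> bool" where
  "fg_module R M \<longleftrightarrow> module R M \<and>
     (\<exists>A. finite A \<and> A \<subseteq> carrier M \<and>
        (\<forall>x\<in>carrier M. \<exists>c\<in>A \<rightarrow> carrier R. x = (\<Oplus>\<^bsub>M\<^esub>a\<in>A. c a \<odot>\<^bsub>M\<^esub> a)))"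

definition module_hom ::
    "('a, 'm) ring_scheme \<Rightarrow> ('a, 'b) module \<Rightarrow> ('a, 'c) module \<Rightarrow> ('b \<Rightarrow> 'c) set" where
  "module_hom R M W =
     {f \<in> carrier M \<rightarrow> carrier W.
        (\<forall>x\<in>carrier M. \<forall>y\<in>carrier M. f (x \<oplus>\<^bsub>M\<^esub> y) = f x \<oplus>\<^bsub>W\<^esub> f y) \<and>
        (\<forall>r\<in>carrier R. \<forall>x\<in>carrier M. f (r \<odot>\<^bsub>M\<^esub> x) = r \<odot>\<^bsub>W\<^esub> f x)}"

definition module_epi ::
    "('a, 'm) ring_scheme \<Rightarrow> ('a, 'b) module \<Rightarrow> ('a, 'c) module \<Rightarrow> ('b \<Rightarrow> 'c) set" where
  "module_epi R M W = {f \<in> module_hom R M W. f ` carrier M = carrier W}"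

definition module_iso ::
    "('a, 'm) ring_scheme \<Rightarrow> ('a, 'b) module \<Rightarrow> ('a, 'c) module \<Rightarrow> ('b \<Rightarrow> 'c) set" where
  "module_iso R M W = {f \<in> module_hom R M W. bij_betw f (carrier M) (carrier W)}"

definition module_ker :: "('a, 'b) module \<Rightarrow> ('a, 'c) module \<Rightarrow> ('b \<Rightarrow> 'c) \<Rightarrow> 'b set" where
  "module_ker M W f = {x \<in> carrier M. f x = \<zero>\<^bsub>W\<^esub>}"

text \<open>In the three modules below the multiplication and unit fields, which the record type for
  modules inherits from rings, play no role.\<close>

definition regular_module :: "('a, 'm) ring_scheme \<Rightarrow> ('a, 'a) module" where
  "regular_module R =
     \<lparr>carrier = carrier R, monoid.mult = (\<otimes>\<^bsub>R\<^esub>), one = \<one>\<^bsub>R\<^esub>, ring.zero = \<zero>\<^bsub>R\<^esub>, ring.add = (\<oplus>\<^bsub>R\<^esub>),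
      smult = (\<otimes>\<^bsub>R\<^esub>)\<rparr>"

definition quotient_module :: "('a, 'm) ring_scheme \<Rightarrow> 'a set \<Rightarrow> ('a, 'a set) module" where
  "quotient_module R J =
     \<lparr>carrier = carrier (R Quot J), monoid.mult = (\<otimes>\<^bsub>R Quot J\<^esub>),
      one = \<one>\<^bsub>R Quot J\<^esub>, ring.zero = \<zero>\<^bsub>R Quot J\<^esub>, ring.add = (\<oplus>\<^bsub>R Quot J\<^esub>),
      smult = (\<lambda>r C. rcoset_mult R J (J +>\<^bsub>R\<^esub> r) C)\<rparr>"

definition free_module :: "('a, 'm) ring_scheme \<Rightarrow> nat \<Rightarrow> ('a, nat \<Rightarrow> 'a) module" where
  "free_module R s =
     \<lparr>carrier = {..<s} \<rightarrow>\<^sub>E carrier R,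
      monoid.mult = (\<lambda>u v. \<lambda>i\<in>{..<s}. u i \<otimes>\<^bsub>R\<^esub> v i), one = (\<lambda>i\<in>{..<s}. \<one>\<^bsub>R\<^esub>),
      ring.zero = (\<lambda>i\<in>{..<s}. \<zero>\<^bsub>R\<^esub>), ring.add = (\<lambda>u v. \<lambda>i\<in>{..<s}. u i \<oplus>\<^bsub>R\<^esub> v i),
      smult = (\<lambda>r v. \<lambda>i\<in>{..<s}. r \<otimes>\<^bsub>R\<^esub> v i)\<rparr>"


section \<open>Closure operations and Dietz closures\<close>

text \<open>A closure operation ranges over the finitely generated modules whose carrier lies in a type
  \<open>'b\<close>. It is meant to be used with a type that is large enough for every finitely generated
  \<open>R\<close>-module to have an isomorphic copy in it, which is the case as soon as the lists over
  \<open>R\<close> embed into \<open>'b\<close>; see \<open>fg_module_copy\<close> below.\<close>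

definition large_universe :: "('a, 'm) ring_scheme \<Rightarrow> 'b itself \<Rightarrow> bool" where
  "large_universe R (_ :: 'b itself) \<longleftrightarrow> (\<exists>e :: 'a list \<Rightarrow> 'b. inj_on e (lists (carrier R)))"

definition closure_operation ::
    "('a, 'm) ring_scheme \<Rightarrow> (('a, 'b) module \<Rightarrow> 'b set \<Rightarrow> 'b set) \<Rightarrow> bool" where
  "closure_operation R cl \<longleftrightarrow>
     (\<forall>M N. fg_module R M \<and> submodule N R M \<longrightarrow>
        submodule (cl M N) R M \<and> N \<subseteq> cl M N \<and> cl M (cl M N) = cl M N) \<and>
     (\<forall>M N N'. fg_module R M \<and> submodule N R M \<and> submodule N' R M \<and> N \<subseteq> N' \<longrightarrow>
        cl M N \<subseteq> cl M N')"

definition functorial where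
  "functorial R (cl :: ('a, 'b) module \<Rightarrow> 'b set \<Rightarrow> 'b set) \<longleftrightarrow>
     (\<forall>M W N f. fg_module R M \<and> fg_module R W \<and> submodule N R M \<and> f \<in> module_hom R M W \<longrightarrow>
        f ` cl M N \<subseteq> cl W (f ` N))"

text \<open>The cosets of \<open>N\<close> do not live in the type \<open>'b\<close>, so \<open>M/N\<close> is represented by any module
  \<open>Q\<close> with a surjection from \<open>M\<close> whose kernel is \<open>N\<close>. Likewise, in \<open>faithful_closure\<close> and
  \<open>extends_integral_closure\<close>, the module \<open>R\<close> is represented by its isomorphic copies.\<close>

definition semi_residual where
  "semi_residual R (cl :: ('a, 'b) module \<Rightarrow> 'b set \<Rightarrow> 'b set) \<longleftrightarrow>
     (\<forall>M N Q p. fg_module R M \<and> submodule N R M \<and> fg_module R Q \<and>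
        p \<in> module_epi R M Q \<and> module_ker M Q p = N \<and> cl M N = N \<longrightarrow>
        cl Q {\<zero>\<^bsub>Q\<^esub>} = {\<zero>\<^bsub>Q\<^esub>})"

definition faithful_closure where
  "faithful_closure R (cl :: ('a, 'b) module \<Rightarrow> 'b set \<Rightarrow> 'b set) \<longleftrightarrow>
     (\<forall>M f. fg_module R M \<and> f \<in> module_iso R (regular_module R) M \<longrightarrow>
        cl M (f ` max_ideal R) = f ` max_ideal R)"

definition generalized_colon_capturing where
  "generalized_colon_capturing R (cl :: ('a, 'b) module \<Rightarrow> 'b set \<Rightarrow> 'b set) \<longleftrightarrow>
     (\<forall>xs x M f v. let J = genideal R (set xs) in
        partial_system_of_parameters R (xs @ [x]) \<and> fg_module R M \<and>
        f \<in> module_epi R M (quotient_module R J) \<and> v \<in> carrier M \<and> f v = J +>\<^bsub>R\<^esub> x \<longrightarrow>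
        cl M {r \<odot>\<^bsub>M\<^esub> v | r. r \<in> carrier R} \<inter> module_ker M (quotient_module R J) f
          \<subseteq> cl M {j \<odot>\<^bsub>M\<^esub> v | j. j \<in> J})"

definition dietz_closure ::
    "('a, 'm) ring_scheme \<Rightarrow> (('a, 'b) module \<Rightarrow> 'b set \<Rightarrow> 'b set) \<Rightarrow> bool" where
  "dietz_closure R cl \<longleftrightarrow>
     closure_operation R cl \<and> functorial R cl \<and> semi_residual R cl \<and> faithful_closure R cl \<and>
     generalized_colon_capturing R cl"


section \<open>Integral closure\<close>

text \<open>\<open>integral_equation R A r\<close>: some relation
  \<open>r\<^sup>n + a\<^sub>1 r\<^sup>n\<^sup>-\<^sup>1 + \<dots> + a\<^sub>n = 0\<close> with \<open>n \<ge> 1\<close> and \<open>a\<^sub>i \<in> A i\<close> holds. For ideals, \<open>A i\<close> is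
  the \<open>i\<close>-th power; for integrality over a subring \<open>T\<close>, it is \<open>T\<close>.\<close>

definition integral_equation :: "('a, 'm) ring_scheme \<Rightarrow> (nat \<Rightarrow> 'a set) \<Rightarrow> 'a \<Rightarrow> bool" where
  "integral_equation R A r \<longleftrightarrow>
     (\<exists>n\<ge>1. \<exists>a. (\<forall>i\<in>{1..n}. a i \<in> A i) \<and>
        r [^]\<^bsub>R\<^esub> n \<oplus>\<^bsub>R\<^esub> (\<Oplus>\<^bsub>R\<^esub>i\<in>{1..n}. a i \<otimes>\<^bsub>R\<^esub> r [^]\<^bsub>R\<^esub> (n - i)) = \<zero>\<^bsub>R\<^esub>)"

definition ideal_power :: "('a, 'm) ring_scheme \<Rightarrow> 'a set \<Rightarrow> nat \<Rightarrow> 'a set" where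
  "ideal_power R I n = (ideal_prod R I ^^ n) (carrier R)"

definition ideal_integral_closure :: "('a, 'm) ring_scheme \<Rightarrow> 'a set \<Rightarrow> 'a set" where
  "ideal_integral_closure R I = {r \<in> carrier R. integral_equation R (ideal_power R I) r}"

definition integral_closure_in :: "('a, 'm) ring_scheme \<Rightarrow> 'a set \<Rightarrow> 'a set" where
  "integral_closure_in S T = {z \<in> carrier S. integral_equation S (\<lambda>_. T) z}"

text \<open>The symmetric algebra of \<open>R\<^sup>s\<close> is the polynomial ring over \<open>R\<close> in the variables
  \<open>X\<^sub>i\<close>, \<open>i < s\<close>, where \<open>X\<^sub>i\<close> is the \<open>i\<close>-th standard basis vector in degree 1. As in
  \<^theory>\<open>HOL-Algebra.Indexed_Polynomials\<close>, a polynomial maps monomials (multisets of indices) to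
  coefficients.\<close>

definition sym_algebra :: "('a, 'm) ring_scheme \<Rightarrow> nat \<Rightarrow> (nat multiset \<Rightarrow> 'a) ring" where
  "sym_algebra R s =
     \<lparr>carrier = ring.indexed_pset R {..<s} (carrier R),
      monoid.mult = (\<lambda>p q m. \<Oplus>\<^bsub>R\<^esub>k\<in>{k. k \<subseteq># m}. p k \<otimes>\<^bsub>R\<^esub> q (m - k)),
      one = ring.indexed_const R \<one>\<^bsub>R\<^esub>,
      ring.zero = ring.indexed_const R \<zero>\<^bsub>R\<^esub>,
      ring.add = ring.indexed_padd R\<rparr>"

text \<open>The embedding of \<open>R\<^sup>s\<close> as the degree 1 part: \<open>v\<close> goes to \<open>\<Sum>\<^sub>i v\<^sub>i X\<^sub>i\<close>.\<close>

definition linear_form :: "('a, 'm) ring_scheme \<Rightarrow> nat \<Rightarrow> (nat \<Rightarrow> 'a) \<Rightarrow> nat multiset \<Rightarrow> 'a" where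
  "linear_form R s v =
     (\<Oplus>\<^bsub>sym_algebra R s\<^esub>i\<in>{..<s}. ring.indexed_pmult R (ring.indexed_const R (v i)) i)"

definition rees_subring ::
    "('a, 'm) ring_scheme \<Rightarrow> nat \<Rightarrow> (nat \<Rightarrow> 'a) set \<Rightarrow> (nat multiset \<Rightarrow> 'a) set" where
  "rees_subring R s G =
     generate_ring (sym_algebra R s)
       (ring.indexed_const R ` carrier R \<union> linear_form R s ` G)"

definition free_integral_closure ::
    "('a, 'm) ring_scheme \<Rightarrow> nat \<Rightarrow> (nat \<Rightarrow> 'a) set \<Rightarrow> (nat \<Rightarrow> 'a) set" where
  "free_integral_closure R s G =
     {v \<in> carrier (free_module R s).
        linear_form R s v \<in> integral_closure_in (sym_algebra R s) (rees_subring R s G)}"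

text \<open>The image of the integral closure of \<open>\<pi>\<^sup>-\<^sup>1(N)\<close> does not depend on the surjection
  \<open>\<pi> : R\<^sup>s \<rightarrow> M\<close>: a map between two free modules over \<open>M\<close> extends to their symmetric algebras
  and so respects integrality. The union over all \<open>\<pi>\<close> is therefore the value for any one of
  them.\<close>

definition liftable_integral_closure ::
    "('a, 'm) ring_scheme \<Rightarrow> ('a, 'b) module \<Rightarrow> 'b set \<Rightarrow> 'b set" where
  "liftable_integral_closure R M N =
     (\<Union>s. \<Union>\<pi>\<in>module_epi R (free_module R s) M.
        \<pi> ` free_integral_closure R s {v \<in> carrier (free_module R s). \<pi> v \<in> N})"

text \<open>The closure of every ideal of \<open>R\<close> in \<open>R\<close> is its integral closure.\<close>

definition extends_integral_closure where
  "extends_integral_closure R (cl :: ('a, 'b) module \<Rightarrow> 'b set \<Rightarrow> 'b set) \<longleftrightarrow>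
     (\<forall>I M f. ideal I R \<and> fg_module R M \<and> f \<in> module_iso R (regular_module R) M \<longrightarrow>
        cl M (f ` I) = f ` ideal_integral_closure R I)"


section \<open>Copies of finitely generated modules\<close>

lemma module_transport:
  fixes M :: "('a, 'c) module" and g :: "'c \<Rightarrow> 'b"
  assumes M: "module R M" and inj: "inj_on g (carrier M)"
  obtains W :: "('a, 'b) module" where "module R W" "g \<in> module_iso R M W"
proof -
  interpret M: module R M by (rule M)
  define h where "h = inv_into (carrier M) g"
  have hg [simp]: "h (g x) = x" if "x \<in> carrier M" for x
    using that inj by (simp add: h_def)
  define W :: "('a, 'b) module" where
    "W = \<lparr>carrier = g ` carrier M, monoid.mult = undefined, one = undefined, ring.zero = g \<zero>\<^bsub>M\<^esub>,
          ring.add = (\<lambda>x y. g (h x \<oplus>\<^bsub>M\<^esub> h y)), smult = (\<lambda>r x. g (r \<odot>\<^bsub>M\<^esub> h x))\<rparr>"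
  have "abelian_group W"
  proof (rule abelian_groupI)
    show "\<exists>y\<in>carrier W. y \<oplus>\<^bsub>W\<^esub> x = \<zero>\<^bsub>W\<^esub>" if x: "x \<in> carrier W" for x
    proof -
      obtain u where u: "u \<in> carrier M" "x = g u" using x by (auto simp: W_def)
      show ?thesis
        by (rule bexI[of _ "g (\<ominus>\<^bsub>M\<^esub> u)"]) (use u in \<open>auto simp: W_def M.M.l_neg\<close>)
    qed
  qed (auto simp: W_def M.M.a_ac)
  hence "module R W"
    by (intro moduleI M.R.is_cring)
       (auto simp: W_def M.smult_l_distr M.smult_r_distr M.smult_assoc1)
  moreover have "g \<in> module_iso R M W"
    using inj by (auto simp: module_iso_def module_hom_def W_def bij_betw_def)
  ultimately show ?thesis by (rule that)
qed

lemma fg_module_copy: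
  fixes M :: "('a, 'c) module"
  assumes fg: "fg_module R M" and large: "large_universe R TYPE('b)"
  shows "\<exists>(W :: ('a, 'b) module) g. module R W \<and> g \<in> module_iso R M W"
proof -
  obtain e :: "'a list \<Rightarrow> 'b" where e: "inj_on e (lists (carrier R))"
    using large by (auto simp: large_universe_def)
  obtain A where A: "finite A" "A \<subseteq> carrier M"
    and gen: "\<forall>x\<in>carrier M. \<exists>c\<in>A \<rightarrow> carrier R. x = (\<Oplus>\<^bsub>M\<^esub>a\<in>A. c a \<odot>\<^bsub>M\<^esub> a)"
    and M: "module R M"
    using fg by (auto simp: fg_module_def)
  interpret M: module R M by (rule M)
  obtain c where c: "\<And>x. x \<in> carrier M \<Longrightarrow> c x \<in> A \<rightarrow> carrier R"
      "\<And>x. x \<in> carrier M \<Longrightarrow> x = (\<Oplus>\<^bsub>M\<^esub>a\<in>A. c x a \<odot>\<^bsub>M\<^esub> a)"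
    using gen by metis
  obtain as where as: "set as = A" using A finite_list by blast
  have "inj_on (\<lambda>x. e (map (c x) as)) (carrier M)"
  proof (rule inj_onI)
    fix x y assume x: "x \<in> carrier M" and y: "y \<in> carrier M"
      and eq: "e (map (c x) as) = e (map (c y) as)"
    have "map (c x) as \<in> lists (carrier R)" "map (c y) as \<in> lists (carrier R)"
      using c(1)[OF x] c(1)[OF y] as by auto
    with eq e have "map (c x) as = map (c y) as" by (auto dest: inj_onD)
    hence *: "c x a = c y a" if "a \<in> A" for a using that as by auto
    have "(\<Oplus>\<^bsub>M\<^esub>a\<in>A. c x a \<odot>\<^bsub>M\<^esub> a) = (\<Oplus>\<^bsub>M\<^esub>a\<in>A. c y a \<odot>\<^bsub>M\<^esub> a)"
      using A c(1)[OF y] * by (intro M.M.finsum_cong') auto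
    thus "x = y" using c(2)[OF x] c(2)[OF y] by simp
  qed
  from module_transport[OF M this] show ?thesis by metis
qed

end

theory Submission
  imports Defs
begin

text \<open>Let \<open>x, y, \<dots>\<close> be a system of parameters. Then \<open>x y\<close> is integral over \<open>(x\<^sup>2, y\<^sup>2)\<close>, as
  \<open>(x y)\<^sup>2 = x\<^sup>2 y\<^sup>2\<close>, but it cannot lie in the closure of \<open>(x\<^sup>2, y\<^sup>2)\<close> for a Dietz closure. In
  \<open>R/(y\<^sup>2) \<oplus> R/(x)\<close> let \<open>v = (x, 1)\<close>; by functoriality \<open>(x y, 0)\<close> is in the closure of \<open>R v\<close>, which
  contains \<open>x v = (x\<^sup>2, 0)\<close>, and so is \<open>(0, y) = y v - (x y, 0)\<close>. It is in the kernel of the projection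
  to \<open>R/(y\<^sup>2)\<close>, so colon-capturing puts it in the closure of \<open>y\<^sup>2 v\<close>, and hence \<open>y\<close> is in the closure of
  \<open>(y\<^sup>2)\<close> in \<open>R/(x)\<close>. The same argument in \<open>R/(x) \<oplus> R/(y)\<close> with \<open>v = (y, 1)\<close> shows that \<open>1\<close> is in the
  closure of \<open>(x)\<close> in \<open>R/(y)\<close>. Mapping to \<open>R/m\<close>, where \<open>0\<close> is closed by faithfulness and
  semi-residuality, gives \<open>1 \<in> m\<close>. That a system of parameters exists at all rests on Krull's height
  theorem (finiteness of the dimension) and prime avoidance.\<close>


section \<open>Krull's height theorem\<close>

text \<open>If \<open>x\<close>, \<open>y\<close> behaved like a regular sequence,
  \<open>x y\<close> in \<open>(x^2, y^2)\<close> would force \<open>1\<close> into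
  \<open>(x, y)\<close>: cancel \<open>x\<close> modulo \<open>y^2\<close> to get \<open>y\<close>
  in \<open>(x, y^2)\<close>, then cancel \<open>y\<close> modulo \<open>x\<close>. Each use of
  colon-capturing performs one such cancellation inside the closure. That axiom speaks only of
  elements of \<open>ker f\<close>, so the module in which the result is to be read off is added as
  a second summand, killed by \<open>f\<close>, and the entry \<open>1\<close> of \<open>v\<close>
  carries multipliers of \<open>v\<close> over to it. This dictates the moduli: the first summand is
  killed by the parameter modulo which one cancels, the second by the factor that is cancelled, so
  that the multiple of \<open>v\<close> at hand has second entry zero. Krull's theorems argue in
  localizations and quotients, but neither is constructed: saturated ideals of \<open>R\<close>
  replace ideals of a localization, and ideals over a fixed prime replace ideals of a quotient.
  Likewise the closure only sees modules in the type \<open>'b\<close>, so direct sums are built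
  from cosets and then copied into the required type.\<close>

locale noetherian_cring = noetherian_ring R + cring R for R (structure)

section \<open>Ideals, primes and adjoining one element\<close>

lemma (in cring) idealI_cring:
  assumes "I \<subseteq> carrier R" "\<zero> \<in> I"
    and add: "\<And>a b. a \<in> I \<Longrightarrow> b \<in> I \<Longrightarrow> a \<oplus> b \<in> I"
    and mult: "\<And>r a. r \<in> carrier R \<Longrightarrow> a \<in> I \<Longrightarrow> r \<otimes> a \<in> I"
  shows "ideal I R"
proof (rule idealI)
  show "subgroup I (add_monoid R)"
  proof (rule group.subgroupI)
    show "inv\<^bsub>add_monoid R\<^esub> a \<in> I" if "a \<in> I" for a
    proof -
      have "a \<in> carrier R" using that assms(1) by blast
      then have "\<ominus> a = (\<ominus> \<one>) \<otimes> a" by algebra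
      then have "\<ominus> a \<in> I" using mult[of "\<ominus> \<one>" a] that by simp
      then show ?thesis by (simp add: a_inv_def)
    qed
  qed (use assms add.is_group in auto)
  show "ring R" by (rule ring_axioms)
  fix a x assume "a \<in> I" "x \<in> carrier R"
  then show "x \<otimes> a \<in> I" "a \<otimes> x \<in> I" using mult assms(1) m_comm[of a x] by auto
qed

lemma (in ring) ideal_add: "ideal I R \<Longrightarrow> a \<in> I \<Longrightarrow> b \<in> I \<Longrightarrow> a \<oplus> b \<in> I"
  by (simp add: additive_subgroup.a_closed ideal.axioms(1))

lemma (in ring) ideal_minus: "ideal I R \<Longrightarrow> a \<in> I \<Longrightarrow> b \<in> I \<Longrightarrow> a \<ominus> b \<in> I"
  unfolding a_minus_def by (simp add: additive_subgroup.a_closed additive_subgroup.a_inv_closed ideal.axioms(1))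

lemma (in ring) ideal_zero: "ideal I R \<Longrightarrow> \<zero> \<in> I"
  by (simp add: additive_subgroup.zero_closed ideal.axioms(1))

lemma (in ring) ideal_add_cancel:
  assumes "ideal I R" "a \<in> I" "b \<in> carrier R" "a \<oplus> b \<in> I"
  shows "b \<in> I"
proof -
  have "a \<in> carrier R" using ideal.Icarr[OF assms(1,2)] .
  then have "(a \<oplus> b) \<ominus> a = b" using assms(3)
    by (simp add: a_minus_def a_comm[of a b] a_assoc r_neg)
  then show ?thesis using ideal_minus[OF assms(1,4,2)] by simp
qed

lemma (in cring) prime_power_mem:
  assumes "primeideal P R" "a \<in> carrier R" "a [^] (n::nat) \<in> P"
  shows "a \<in> P"
  using assms(3)
proof (induction n)
  case 0
  then show ?case
    using primeideal.I_notcarr[OF assms(1)] ideal.one_imp_carrier[OF primeideal.axioms(1)[OF assms(1)]]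
    by auto
next
  case (Suc n)
  then show ?case using primeideal.I_prime[OF assms(1), of "a [^] n" a] assms(2) by auto
qed

lemma (in cring) prime_one_notin: "primeideal P R \<Longrightarrow> \<one> \<notin> P"
  using primeideal.I_notcarr ideal.one_imp_carrier primeideal.axioms(1) by metis

text \<open>This is \<open>I + Rx\<close> for an ideal \<open>I\<close>, given by a normal form
  rather than as a generated ideal, so that membership directly yields coefficients.\<close>

definition adjoin :: "('a, 'm) ring_scheme \<Rightarrow> 'a set \<Rightarrow> 'a \<Rightarrow> 'a set" where
  "adjoin R I x = {i \<oplus>\<^bsub>R\<^esub> a \<otimes>\<^bsub>R\<^esub> x | i a. i \<in> I \<and> a \<in> carrier R}"

context cring
begin

lemma adjoinE:
  assumes "r \<in> adjoin R I x"
  obtains i a where "i \<in> I" "a \<in> carrier R" "r = i \<oplus> a \<otimes> x"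
  using assms by (auto simp: adjoin_def)

lemma adjoin_ideal:
  assumes I: "ideal I R" and x: "x \<in> carrier R"
  shows "ideal (adjoin R I x) R"
proof (rule idealI_cring)
  note Ic = ideal.Icarr[OF I]
  show "adjoin R I x \<subseteq> carrier R" using Ic x by (auto simp: adjoin_def)
  have "\<zero> = \<zero> \<oplus> \<zero> \<otimes> x" using x by simp
  then show "\<zero> \<in> adjoin R I x" using ideal_zero[OF I] unfolding adjoin_def by blast
  fix u v assume "u \<in> adjoin R I x" "v \<in> adjoin R I x"
  then obtain i a j b where *: "i \<in> I" "j \<in> I" "a \<in> carrier R" "b \<in> carrier R"
    "u = i \<oplus> a \<otimes> x" "v = j \<oplus> b \<otimes> x" by (auto simp: adjoin_def)
  have "u \<oplus> v = (i \<oplus> j) \<oplus> (a \<oplus> b) \<otimes> x" unfolding *(5,6) using *(3,4) Ic[OF *(1)] Ic[OF *(2)] x by algebra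
  then show "u \<oplus> v \<in> adjoin R I x" using * ideal_add[OF I *(1,2)] unfolding adjoin_def by blast
next
  fix r u assume r: "r \<in> carrier R" and "u \<in> adjoin R I x"
  then obtain i a where *: "i \<in> I" "a \<in> carrier R" "u = i \<oplus> a \<otimes> x" by (auto simp: adjoin_def)
  have "r \<otimes> u = r \<otimes> i \<oplus> (r \<otimes> a) \<otimes> x" unfolding *(3) using *(2) ideal.Icarr[OF I *(1)] r x by algebra
  then show "r \<otimes> u \<in> adjoin R I x" using * r ideal.I_l_closed[OF I *(1) r] unfolding adjoin_def by blast
qed

lemma adjoin_superset:
  assumes "ideal I R" "x \<in> carrier R" shows "I \<subseteq> adjoin R I x"
proof
  fix i assume "i \<in> I"
  moreover have "i = i \<oplus> \<zero> \<otimes> x" using assms ideal.Icarr[OF assms(1) \<open>i \<in> I\<close>] by simp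
  ultimately show "i \<in> adjoin R I x" unfolding adjoin_def by blast
qed

lemma adjoin_self:
  assumes "ideal I R" "x \<in> carrier R" shows "x \<in> adjoin R I x"
proof -
  have "x = \<zero> \<oplus> \<one> \<otimes> x" using assms by simp
  then show ?thesis using ideal_zero[OF assms(1)] unfolding adjoin_def by blast
qed

lemma adjoin_subset:
  assumes "ideal J R" "I \<subseteq> J" "x \<in> J" shows "adjoin R I x \<subseteq> J"
proof
  fix r assume "r \<in> adjoin R I x"
  then obtain i a where "i \<in> I" "a \<in> carrier R" "r = i \<oplus> a \<otimes> x" by (rule adjoinE)
  then show "r \<in> J" using ideal_add[OF assms(1)] ideal.I_l_closed[OF assms(1,3)] assms(2) by blast
qed

lemma adjoin_mono: "I \<subseteq> J \<Longrightarrow> adjoin R I x \<subseteq> adjoin R J x"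
  unfolding adjoin_def by blast

end

section \<open>Saturated ideals at a prime\<close>

text \<open>\<open>saturation R P I\<close> is the contraction to \<open>R\<close> of the extension of \<open>I\<close> to the localization
  of \<open>R\<close> at \<open>P\<close>; the saturated ideals stand for the ideals of the localization.\<close>

definition saturation :: "('a, 'm) ring_scheme \<Rightarrow> 'a set \<Rightarrow> 'a set \<Rightarrow> 'a set" where
  "saturation R P I = {r \<in> carrier R. \<exists>s\<in>carrier R - P. s \<otimes>\<^bsub>R\<^esub> r \<in> I}"

definition saturated :: "('a, 'm) ring_scheme \<Rightarrow> 'a set \<Rightarrow> 'a set \<Rightarrow> bool" where
  "saturated R P I \<longleftrightarrow> ideal I R \<and> saturation R P I \<subseteq> I"

context cring
begin

lemma prime_compl_mult:
  assumes "primeideal P R" "s \<in> carrier R - P" "t \<in> carrier R - P"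
  shows "s \<otimes> t \<in> carrier R - P"
  using primeideal.I_prime[OF assms(1)] assms(2,3) by blast

lemma saturation_superset:
  assumes "primeideal P R" "ideal I R" shows "I \<subseteq> saturation R P I"
proof
  fix i assume i: "i \<in> I"
  then have "\<one> \<otimes> i \<in> I" "i \<in> carrier R" using ideal.Icarr[OF assms(2)] by simp_all
  then show "i \<in> saturation R P I"
    using prime_one_notin[OF assms(1)] unfolding saturation_def by blast
qed

lemma saturation_saturated:
  assumes P: "primeideal P R" and I: "ideal I R"
  shows "saturated R P (saturation R P I)"
proof -
  have "ideal (saturation R P I) R"
  proof (rule idealI_cring)
    show "saturation R P I \<subseteq> carrier R" by (auto simp: saturation_def)
    show "\<zero> \<in> saturation R P I" using saturation_superset[OF P I] ideal_zero[OF I] by blast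
    fix a b assume "a \<in> saturation R P I" "b \<in> saturation R P I"
    then obtain s t where *: "s \<in> carrier R - P" "t \<in> carrier R - P" "s \<otimes> a \<in> I" "t \<otimes> b \<in> I"
      "a \<in> carrier R" "b \<in> carrier R" by (auto simp: saturation_def)
    have "(s \<otimes> t) \<otimes> (a \<oplus> b) = t \<otimes> (s \<otimes> a) \<oplus> s \<otimes> (t \<otimes> b)"
      using * by (simp add: r_distr m_ac)
    then have "(s \<otimes> t) \<otimes> (a \<oplus> b) \<in> I"
      using * ideal_add[OF I] ideal.I_l_closed[OF I] by auto
    then show "a \<oplus> b \<in> saturation R P I"
      using prime_compl_mult[OF P *(1,2)] *(5,6) unfolding saturation_def by blast
  next
    fix r a assume r: "r \<in> carrier R" and "a \<in> saturation R P I"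
    then obtain s where *: "s \<in> carrier R - P" "s \<otimes> a \<in> I" "a \<in> carrier R" by (auto simp: saturation_def)
    have "s \<otimes> (r \<otimes> a) = r \<otimes> (s \<otimes> a)" using * r by (simp add: m_ac)
    then have "s \<otimes> (r \<otimes> a) \<in> I" using ideal.I_l_closed[OF I *(2) r] by simp
    then show "r \<otimes> a \<in> saturation R P I" using * r unfolding saturation_def by blast
  qed
  moreover have "saturation R P (saturation R P I) \<subseteq> saturation R P I"
  proof
    fix r assume "r \<in> saturation R P (saturation R P I)"
    then obtain s t where *: "s \<in> carrier R - P" "t \<in> carrier R - P" "t \<otimes> (s \<otimes> r) \<in> I" "r \<in> carrier R"
      by (auto simp: saturation_def)
    have "(t \<otimes> s) \<otimes> r \<in> I" using * by (simp add: m_assoc)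
    then show "r \<in> saturation R P I"
      using prime_compl_mult[OF P *(2,1)] *(4) unfolding saturation_def by blast
  qed
  ultimately show ?thesis by (simp add: saturated_def)
qed

lemma saturation_mono: "I \<subseteq> J \<Longrightarrow> saturation R P I \<subseteq> saturation R P J"
  unfolding saturation_def by blast

lemma saturation_subset: "saturated R P J \<Longrightarrow> I \<subseteq> J \<Longrightarrow> saturation R P I \<subseteq> J"
  using saturation_mono[of I J P] unfolding saturated_def by blast

lemma saturatedD:
  "saturated R P I \<Longrightarrow> s \<in> carrier R - P \<Longrightarrow> r \<in> carrier R \<Longrightarrow> s \<otimes> r \<in> I \<Longrightarrow> r \<in> I"
  unfolding saturated_def saturation_def by blast

text \<open>The localization at \<open>Q\<close> is a further localization of the one at the larger
  \<open>P\<close>. Ideals built at \<open>Q\<close> can therefore enter arguments at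
  \<open>P\<close>.\<close>

lemma saturated_antimono: "Q \<subseteq> P \<Longrightarrow> saturated R Q I \<Longrightarrow> saturated R P I"
  unfolding saturated_def saturation_def by blast

lemma saturated_ideal: "saturated R P I \<Longrightarrow> ideal I R"
  by (simp add: saturated_def)

text \<open>\<open>I + Rx\<close> need not be saturated even if \<open>I\<close> is, so every
  enlargement is saturated again; these are the facts that a maximality argument asks of the
  result.\<close>

lemma saturation_adjoin:
  assumes P: "primeideal P R" and I: "ideal I R" and x: "x \<in> carrier R"
  shows "saturated R P (saturation R P (adjoin R I x))"
    "I \<subseteq> saturation R P (adjoin R I x)" "x \<in> saturation R P (adjoin R I x)"
  using saturation_saturated[OF P adjoin_ideal[OF I x]]
    saturation_superset[OF P adjoin_ideal[OF I x]] adjoin_superset[OF I x] adjoin_self[OF I x] by auto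

end

section \<open>Maximal members of families of ideals, and the primes they produce\<close>

context noetherian_cring
begin

text \<open>In a noetherian ring a nonempty chain of ideals contains its own union, so Zorn's lemma
  applies. This is the form in which the noetherian condition is mostly used below.\<close>

lemma maximal_ideal_exists:
  assumes "S \<noteq> {}" and S: "\<And>I. I \<in> S \<Longrightarrow> ideal I R"
  obtains M where "M \<in> S" "\<And>N. N \<in> S \<Longrightarrow> M \<subseteq> N \<Longrightarrow> N = M"
proof -
  have "\<exists>M\<in>S. \<forall>N\<in>S. M \<subseteq> N \<longrightarrow> N = M"
  proof (rule subset_Zorn)
    fix C assume C: "subset.chain S C"
    show "\<exists>U\<in>S. \<forall>J\<in>C. J \<subseteq> U"
    proof (cases "C = {}")
      case True
      then show ?thesis using assms(1) by blast
    next
      case False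
      have "subset.chain {I. ideal I R} C" using C S by (auto simp: pred_on.chain_def)
      from ideal_chain_is_trivial[OF False this] show ?thesis
        using C by (auto simp: pred_on.chain_def)
    qed
  qed
  then show ?thesis using that by blast
qed

text \<open>An ideal \<open>M\<close> maximal among those over \<open>I\<close> that miss
  \<open>S\<close> is prime: for \<open>a\<close>, \<open>b\<close> outside \<open>M\<close>, both
  \<open>M + Ra\<close> and \<open>M + Rb\<close> meet \<open>S\<close>, and if \<open>a b\<close>
  were in \<open>M\<close>, the product of two such elements would lie in both \<open>M\<close> and
  \<open>S\<close>.\<close>

lemma exists_prime_disjoint:
  assumes I: "ideal I R" and S: "S \<subseteq> carrier R" "\<one> \<in> S"
    "\<And>a b. a \<in> S \<Longrightarrow> b \<in> S \<Longrightarrow> a \<otimes> b \<in> S" and disj: "I \<inter> S = {}"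
  obtains P where "primeideal P R" "I \<subseteq> P" "P \<inter> S = {}"
proof -
  define F where "F = {J. ideal J R \<and> I \<subseteq> J \<and> J \<inter> S = {}}"
  have "F \<noteq> {}" using I disj unfolding F_def by blast
  then obtain M where M: "M \<in> F" "\<And>N. N \<in> F \<Longrightarrow> M \<subseteq> N \<Longrightarrow> N = M"
    using maximal_ideal_exists[of F] unfolding F_def by blast
  have MI: "ideal M R" using M(1) by (simp add: F_def)
  have "primeideal M R"
  proof (rule primeidealI[OF MI is_cring])
    show "carrier R \<noteq> M" using M(1) S by (auto simp: F_def)
    fix a b assume ab: "a \<in> carrier R" "b \<in> carrier R" "a \<otimes> b \<in> M"
    have hit: "\<exists>i\<in>M. \<exists>r\<in>carrier R. i \<oplus> r \<otimes> c \<in> S" if "c \<in> carrier R" "c \<notin> M" for c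
    proof -
      have "adjoin R M c \<notin> F"
        using M(2) adjoin_superset[OF MI that(1)] adjoin_self[OF MI that(1)] that(2) by blast
      then have "adjoin R M c \<inter> S \<noteq> {}"
        using adjoin_ideal[OF MI that(1)] adjoin_superset[OF MI that(1)] M(1) unfolding F_def by blast
      then show ?thesis unfolding adjoin_def by blast
    qed
    show "a \<in> M \<or> b \<in> M"
    proof (rule ccontr)
      assume "\<not> (a \<in> M \<or> b \<in> M)"
      then obtain i r j t where *: "i \<in> M" "r \<in> carrier R" "i \<oplus> r \<otimes> a \<in> S"
        "j \<in> M" "t \<in> carrier R" "j \<oplus> t \<otimes> b \<in> S" using hit ab by meson
      have c: "i \<in> carrier R" "j \<in> carrier R" using * ideal.Icarr[OF MI] by auto
      have "(i \<oplus> r \<otimes> a) \<otimes> (j \<oplus> t \<otimes> b) = ((j \<oplus> t \<otimes> b) \<otimes> i \<oplus> (r \<otimes> a) \<otimes> j) \<oplus> (r \<otimes> t) \<otimes> (a \<otimes> b)"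
        using c *(2,5) ab(1,2) by algebra
      moreover have "\<dots> \<in> M"
        using ideal_add[OF MI] ideal.I_l_closed[OF MI] c * ab by simp
      ultimately have "(i \<oplus> r \<otimes> a) \<otimes> (j \<oplus> t \<otimes> b) \<in> M \<inter> S" using S(3)[OF *(3,6)] by simp
      then show False using M(1) by (auto simp: F_def)
    qed
  qed
  then show ?thesis using that M(1) by (auto simp: F_def)
qed

text \<open>In the localization at \<open>P\<close>, the only prime over \<open>I\<close> is
  \<open>P\<close>, so its elements are nilpotent modulo \<open>I\<close>. Concretely, a prime over
  \<open>I\<close> that misses all \<open>s p^k\<close> would lie in \<open>P\<close>, hence equal
  \<open>P\<close>, and yet miss \<open>p\<close>.\<close>

lemma power_mem_of_minimal_prime:
  assumes P: "primeideal P R" and I: "ideal I R" and p: "p \<in> P"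
    and min: "\<And>P'. primeideal P' R \<Longrightarrow> I \<subseteq> P' \<Longrightarrow> P' \<subseteq> P \<Longrightarrow> P' = P"
  obtains s and k :: nat where "s \<in> carrier R - P" "s \<otimes> p [^] k \<in> I"
proof -
  have pc: "p \<in> carrier R" using ideal.Icarr[OF primeideal.axioms(1)[OF P] p] .
  define S where "S = {s \<otimes> p [^] k | s k. s \<in> carrier R - P \<and> k \<in> (UNIV :: nat set)}"
  have S0: "s \<in> S" if "s \<in> carrier R - P" for s
  proof -
    have "s = s \<otimes> p [^] (0::nat)" using that by simp
    then show ?thesis using that unfolding S_def by blast
  qed
  have "I \<inter> S \<noteq> {}"
  proof
    assume disj: "I \<inter> S = {}"
    have "S \<subseteq> carrier R" using pc by (auto simp: S_def)
    moreover have "\<one> \<in> S" using prime_one_notin[OF P] S0 by blast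
    moreover have "a \<otimes> b \<in> S" if ab: "a \<in> S" "b \<in> S" for a b
    proof -
      obtain s t and k l :: nat where *: "s \<in> carrier R - P" "t \<in> carrier R - P"
        "a = s \<otimes> p [^] k" "b = t \<otimes> p [^] l" using ab by (auto simp: S_def)
      have "a \<otimes> b = (s \<otimes> t) \<otimes> p [^] (k + l)" using * pc by (simp add: m_ac flip: nat_pow_mult)
      then show ?thesis using prime_compl_mult[OF P *(1,2)] unfolding S_def by blast
    qed
    ultimately obtain P' where P': "primeideal P' R" "I \<subseteq> P'" "P' \<inter> S = {}"
      using exists_prime_disjoint[OF I _ _ _ disj] by metis
    have "P' \<subseteq> P" using P'(3) S0 ideal.Icarr[OF primeideal.axioms(1)[OF P'(1)]] by blast
    then have "p \<in> P'" using min P' p by blast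
    moreover have "\<one> \<otimes> p [^] (1::nat) \<in> S" using prime_one_notin[OF P] unfolding S_def by blast
    ultimately show False using P'(3) pc by auto
  qed
  then show ?thesis using that unfolding S_def by blast
qed

text \<open>Among the ideals \<open>K : g\<close> with \<open>g\<close> outside \<open>K\<close>, a
  maximal one is prime. Saturation of \<open>K\<close> puts it inside \<open>P\<close> and
  minimality makes it equal to \<open>P\<close>, so \<open>g\<close> spans a copy of the residue
  field in the localization of \<open>R/K\<close> at \<open>P\<close>.\<close>

lemma exists_associated_element:
  assumes K: "saturated R P K" "K \<noteq> carrier R" and P: "primeideal P R"
    and min: "\<And>P'. primeideal P' R \<Longrightarrow> K \<subseteq> P' \<Longrightarrow> P' \<subseteq> P \<Longrightarrow> P' = P"
  obtains g where "g \<in> carrier R" "g \<notin> K" "\<And>p. p \<in> P \<Longrightarrow> p \<otimes> g \<in> K"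
proof -
  note KI = saturated_ideal[OF K(1)]
  define A where "A = (\<lambda>g. {r \<in> carrier R. g \<otimes> r \<in> K})"
  have AI: "ideal (A g) R" if "g \<in> carrier R" for g
    using ideal.helper_max_prime[OF KI is_cring that] by (simp add: A_def)
  define F where "F = A ` (carrier R - K)"
  have "carrier R - K \<noteq> {}" using K(2) ideal.Icarr[OF KI] by blast
  then have "F \<noteq> {}" by (simp add: F_def)
  then obtain M where M: "M \<in> F" "\<And>N. N \<in> F \<Longrightarrow> M \<subseteq> N \<Longrightarrow> N = M"
    using maximal_ideal_exists[of F] AI unfolding F_def by blast
  then obtain g where g: "g \<in> carrier R" "g \<notin> K" "M = A g" by (auto simp: F_def)
  have "primeideal (A g) R"
  proof (rule primeidealI[OF AI[OF g(1)] is_cring])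
    have "\<one> \<notin> A g" using g by (simp add: A_def)
    then show "carrier R \<noteq> A g" by blast
    fix a b assume ab: "a \<in> carrier R" "b \<in> carrier R" "a \<otimes> b \<in> A g"
    show "a \<in> A g \<or> b \<in> A g"
    proof (rule disjCI)
      assume "b \<notin> A g"
      then have gb: "g \<otimes> b \<in> carrier R - K" using ab g by (simp add: A_def)
      have "A g \<subseteq> A (g \<otimes> b)"
      proof
        fix r assume r: "r \<in> A g"
        then have "g \<otimes> b \<otimes> r = b \<otimes> (g \<otimes> r)" using ab g by (simp add: A_def m_ac)
        then show "r \<in> A (g \<otimes> b)" using r ideal.I_l_closed[OF KI _ ab(2)] by (auto simp: A_def)
      qed
      then have "A (g \<otimes> b) = A g" using M(2) gb g(3) by (simp add: F_def)
      moreover have "a \<in> A (g \<otimes> b)" using ab g by (simp add: A_def m_ac)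
      ultimately show "a \<in> A g" by simp
    qed
  qed
  moreover have "K \<subseteq> A g"
    using ideal.I_l_closed[OF KI _ g(1)] ideal.Icarr[OF KI] by (auto simp: A_def)
  moreover have "A g \<subseteq> P"
  proof
    fix r assume r: "r \<in> A g"
    then have "r \<otimes> g \<in> K" "r \<in> carrier R" using g by (auto simp: A_def m_comm)
    then show "r \<in> P" using saturatedD[OF K(1) _ g(1)] g(2) by blast
  qed
  ultimately have "A g = P" by (rule min)
  then have "p \<otimes> g \<in> K" if "p \<in> P" for p using that g(1) by (auto simp: A_def m_comm)
  then show ?thesis using that g(1,2) by blast
qed

section \<open>Krull's principal ideal theorem and height theorem\<close>

text \<open>Over an ideal whose only prime inside \<open>P\<close> is \<open>P\<close>, the localization at \<open>P\<close> is Artinian.\<close>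

lemma saturated_chain_stabilises:
  fixes I :: "nat \<Rightarrow> 'a set"
  assumes P: "primeideal P R" and K: "ideal K R"
    and min: "\<And>P'. primeideal P' R \<Longrightarrow> K \<subseteq> P' \<Longrightarrow> P' \<subseteq> P \<Longrightarrow> P' = P"
    and I: "\<And>n. saturated R P (I n)" "\<And>n. K \<subseteq> I n" "\<And>n. I (Suc n) \<subseteq> I n"
  shows "\<exists>N. \<forall>n\<ge>N. I N \<subseteq> I n"
proof -
  \<comment> \<open>\<open>D L\<close> is the descending chain condition for saturated ideals over
    \<open>L\<close>. A maximal counterexample \<open>M\<close> is enlarged by an element
    \<open>g\<close> that \<open>P\<close> multiplies into \<open>M\<close>; a chain
    \<open>J n\<close> over \<open>M\<close> is then compared with the saturations of
    \<open>J n + Rg\<close>, which lie over a larger ideal and so stabilise.\<close>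
  define D where "D = (\<lambda>L. \<forall>I :: nat \<Rightarrow> 'a set.
    (\<forall>n. saturated R P (I n) \<and> L \<subseteq> I n \<and> I (Suc n) \<subseteq> I n) \<longrightarrow> (\<exists>N. \<forall>n\<ge>N. I N \<subseteq> I n))"
  define F where "F = {L. saturated R P L \<and> K \<subseteq> L \<and> \<not> D L}"
  have "F = {}"
  proof (rule ccontr)
    assume "F \<noteq> {}"
    moreover have "ideal J R" if "J \<in> F" for J using that saturated_ideal by (auto simp: F_def)
    ultimately obtain M where M: "M \<in> F" "\<And>N. N \<in> F \<Longrightarrow> M \<subseteq> N \<Longrightarrow> N = M"
      using maximal_ideal_exists[of F] by blast
    have Ms: "saturated R P M" "K \<subseteq> M" using M(1) by (auto simp: F_def)
    note MI = saturated_ideal[OF Ms(1)]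
    obtain J :: "nat \<Rightarrow> 'a set" where J: "\<And>n. saturated R P (J n)" "\<And>n. M \<subseteq> J n" "\<And>n. J (Suc n) \<subseteq> J n"
      and unstable: "\<not> (\<exists>N. \<forall>n\<ge>N. J N \<subseteq> J n)"
      using M(1) unfolding F_def D_def by blast
    have JI: "ideal (J n) R" for n using saturated_ideal J(1) .
    have "M \<noteq> carrier R"
    proof
      assume "M = carrier R"
      then have "J n = carrier R" for n using J(2)[of n] ideal.Icarr[OF JI, of _ n] by blast
      then show False using unstable by blast
    qed
    then obtain g where g: "g \<in> carrier R" "g \<notin> M" "\<And>p. p \<in> P \<Longrightarrow> p \<otimes> g \<in> M"
      using exists_associated_element[OF Ms(1) _ P] min Ms(2) by (metis subset_trans)
    define M' where "M' = saturation R P (adjoin R M g)"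
    have M': "saturated R P M'" "M \<subseteq> M'" "g \<in> M'"
      unfolding M'_def using saturation_adjoin[OF P MI g(1)] by auto
    have "M' \<notin> F" using M(2)[of M'] M' g(2) by blast
    then have D: "D M'" using M' Ms(2) unfolding F_def by blast
    define J' where "J' = (\<lambda>n. saturation R P (adjoin R (J n) g))"
    have "saturated R P (J' n)" for n
      unfolding J'_def by (rule saturation_adjoin(1)[OF P JI g(1)])
    moreover have "M' \<subseteq> J' n" for n
      unfolding J'_def M'_def using J(2) by (intro saturation_mono adjoin_mono)
    moreover have "J' (Suc n) \<subseteq> J' n" for n
      unfolding J'_def M'_def using J(3) by (intro saturation_mono adjoin_mono)
    ultimately obtain N where N: "\<And>n. n \<ge> N \<Longrightarrow> J' N \<subseteq> J' n" using D unfolding D_def by blast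
    have anti: "J n \<subseteq> J m" if "m \<le> n" for m n using lift_Suc_antimono_le[of J, OF J(3) that] .
    have anti': "J' n \<subseteq> J' m" if "m \<le> n" for m n
      unfolding J'_def using anti[OF that] by (intro saturation_mono adjoin_mono)
    \<comment> \<open>If \<open>g\<close> is in every \<open>J n\<close>, the two chains agree.
      Otherwise \<open>g\<close> is eventually left out, so a coefficient \<open>a\<close> with
      \<open>a g\<close> in \<open>J N'\<close> must lie in \<open>P\<close>, and then
      \<open>a g\<close> is already in \<open>M\<close>.\<close>
    have "\<exists>N'. \<forall>n\<ge>N'. J N' \<subseteq> J n"
    proof (cases "\<forall>n. g \<in> J n")
      case True
      have "J' n = J n" for n
        using saturation_subset[OF J(1) adjoin_subset[OF JI subset_refl]] True
          saturation_adjoin(2)[OF P JI g(1)] unfolding J'_def by blast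
      then show ?thesis using N by metis
    next
      case False
      then obtain L where L: "g \<notin> J L" by blast
      define N' where "N' = max L N"
      have gN: "g \<notin> J N'" using L anti[of L N'] by (auto simp: N'_def)
      have "J N' \<subseteq> J n" if n: "n \<ge> N'" for n
      proof
        fix r assume r: "r \<in> J N'"
        then have rc: "r \<in> carrier R" using ideal.Icarr[OF JI] by blast
        have "r \<in> J' N'" using r saturation_adjoin(2)[OF P JI g(1)] unfolding J'_def by blast
        then have "r \<in> J' n" using N[of n] anti'[of N N'] n by (auto simp: N'_def)
        then obtain s where s: "s \<in> carrier R - P" "s \<otimes> r \<in> adjoin R (J n) g"
          unfolding J'_def saturation_def by blast
        then obtain t a where ta: "t \<in> J n" "a \<in> carrier R" "s \<otimes> r = t \<oplus> a \<otimes> g" by (elim adjoinE)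
        have "t \<oplus> a \<otimes> g \<in> J N'" using ideal.I_l_closed[OF JI r, of s] s(1) by (simp flip: ta(3))
        then have "a \<otimes> g \<in> J N'"
          using ideal_add_cancel[OF JI] anti[OF n] ta g(1) by blast
        then have "a \<in> P" using saturatedD[OF J(1) _ g(1)] gN ta(2) by blast
        then have "a \<otimes> g \<in> J n" using g(3) J(2) by blast
        then have "s \<otimes> r \<in> J n" unfolding ta(3) using ideal_add[OF JI ta(1)] by blast
        then show "r \<in> J n" using saturatedD[OF J(1) s(1) rc] by blast
      qed
      then show ?thesis by blast
    qed
    then show False using unstable by blast
  qed
  \<comment> \<open>\<open>K\<close> itself need not be saturated, while \<open>F\<close> ranges
    over saturated ideals only.\<close>
  define K' where "K' = saturation R P K"
  have "saturated R P K'" "K \<subseteq> K'"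
    unfolding K'_def using saturation_saturated[OF P K] saturation_superset[OF P K] by auto
  then have "D K'" using \<open>F = {}\<close> unfolding F_def by blast
  moreover have "K' \<subseteq> I n" for n unfolding K'_def using saturation_subset[OF I(1,2)] .
  ultimately show ?thesis using I unfolding D_def by blast
qed

text \<open>This is the theorem for the domain \<open>R/Q0\<close>, stated with ideals over
  \<open>Q0\<close> so that the height theorem can use it for varying \<open>Q0\<close>. For
  \<open>y\<close> in \<open>Q\<close> outside \<open>Q0\<close>, the ideals \<open>(y^n)\<close> at
  \<open>Q\<close> form a descending chain that becomes stationary modulo \<open>x\<close> at
  \<open>P\<close>; Nakayama's lemma removes \<open>x\<close>, and \<open>y^N\<close> in
  \<open>(y^(N+1))\<close> at \<open>Q\<close> is impossible, as \<open>y\<close> is a nonunit there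
  and nonzero modulo \<open>Q0\<close>.\<close>

theorem krull_principal_ideal:
  assumes P: "primeideal P R" and Q: "primeideal Q R" and Q0: "primeideal Q0 R"
    and sub: "Q0 \<subseteq> Q" "Q \<subset> P" and x: "x \<in> P"
    and min: "\<And>P'. primeideal P' R \<Longrightarrow> Q0 \<subseteq> P' \<Longrightarrow> x \<in> P' \<Longrightarrow> P' \<subseteq> P \<Longrightarrow> P' = P"
  shows "Q = Q0"
proof (rule ccontr)
  assume "Q \<noteq> Q0"
  then obtain y where y: "y \<in> Q" "y \<notin> Q0" using sub by blast
  note PI = primeideal.axioms(1)[OF P] and QI = primeideal.axioms(1)[OF Q]
    and Q0I = primeideal.axioms(1)[OF Q0]
  have yc: "y \<in> carrier R" using ideal.Icarr[OF QI y(1)] .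
  have xc: "x \<in> carrier R" using ideal.Icarr[OF PI x] .
  have xQ: "x \<notin> Q" using min[OF Q] sub by blast
  \<comment> \<open>The contraction of \<open>Q0 + (y^n)\<close> from the localization at
    \<open>Q\<close>; the single element \<open>y\<close> takes the place of the ideal
    \<open>Q\<close> in the usual symbolic powers.\<close>
  define I where "I = (\<lambda>n::nat. saturation R Q (adjoin R Q0 (y [^] n)))"
  have IQ: "saturated R Q (I n)" and Iy: "y [^] n \<in> I n" and IQ0: "Q0 \<subseteq> I n" for n
    unfolding I_def using saturation_adjoin[OF Q Q0I, of "y [^] n"] yc by auto
  have IP: "saturated R P (I n)" for n using saturated_antimono[OF _ IQ] sub by blast
  have II: "ideal (I n) R" for n using saturated_ideal[OF IQ] .
  have Idec: "I (Suc n) \<subseteq> I n" for n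
  proof -
    have "y [^] (Suc n) \<in> I n" using ideal.I_r_closed[OF II Iy yc] by simp
    then show ?thesis
      using saturation_subset[OF IQ adjoin_subset[OF II IQ0]] unfolding I_def by blast
  qed
  define H where "H = (\<lambda>n. saturation R P (adjoin R (I n) x))"
  have HP: "saturated R P (H n)" and IH: "I n \<subseteq> H n" and Hx: "x \<in> H n" for n
    unfolding H_def using saturation_adjoin[OF P II xc] by auto
  have "\<exists>N. \<forall>n\<ge>N. H N \<subseteq> H n"
  proof (rule saturated_chain_stabilises[OF P adjoin_ideal[OF Q0I xc]])
    show "P' = P" if "primeideal P' R" "adjoin R Q0 x \<subseteq> P'" "P' \<subseteq> P" for P'
      using min that adjoin_superset[OF Q0I xc] adjoin_self[OF Q0I xc] by blast
    show "adjoin R Q0 x \<subseteq> H n" for n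
      using adjoin_subset[OF saturated_ideal[OF HP] _ Hx] IQ0 IH by blast
    show "H (Suc n) \<subseteq> H n" for n
      unfolding H_def using Idec by (intro saturation_mono adjoin_mono)
  qed (rule HP)
  then obtain N where "H N \<subseteq> H (Suc N)" using le_Suc_eq by blast
  then have INH: "I N \<subseteq> H (Suc N)" using IH by blast
  txt \<open>Nakayama's lemma over the localization at \<open>P\<close>: \<open>I N = I (N + 1) + x I N\<close> there.\<close>
  have "I N \<subseteq> I (Suc N)"
  proof (rule ccontr)
    assume not: "\<not> I N \<subseteq> I (Suc N)"
    \<comment> \<open>For \<open>L\<close> maximal in \<open>F\<close>, the quotient
      \<open>I N / L\<close> is simple over the localization at \<open>P\<close>, so
      \<open>x\<close> in \<open>P\<close> annihilates it: otherwise some \<open>s - a x\<close>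
      outside \<open>P\<close> would multiply \<open>r\<close> into \<open>L\<close>.\<close>
    define F where "F = {L. saturated R P L \<and> I (Suc N) \<subseteq> L \<and> L \<subset> I N}"
    have "I (Suc N) \<in> F" using IP Idec not unfolding F_def by blast
    then have "F \<noteq> {}" by blast
    moreover have "ideal J R" if "J \<in> F" for J using that saturated_ideal by (auto simp: F_def)
    ultimately obtain L where L: "L \<in> F" "\<And>L'. L' \<in> F \<Longrightarrow> L \<subseteq> L' \<Longrightarrow> L' = L"
      using maximal_ideal_exists[of F] by blast
    have Ls: "saturated R P L" "I (Suc N) \<subseteq> L" "L \<subset> I N" using L(1) by (auto simp: F_def)
    note LI = saturated_ideal[OF Ls(1)]
    have xL: "x \<otimes> r \<in> L" if r: "r \<in> I N" for r
    proof (rule ccontr)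
      assume xr: "x \<otimes> r \<notin> L"
      have rc: "r \<in> carrier R" using ideal.Icarr[OF II r] .
      have xrc: "x \<otimes> r \<in> carrier R" using xc rc by simp
      define L' where "L' = saturation R P (adjoin R L (x \<otimes> r))"
      have L': "saturated R P L'" "L \<subseteq> L'" "x \<otimes> r \<in> L'"
        unfolding L'_def using saturation_adjoin[OF P LI xrc] by auto
      have "L' \<subseteq> I N"
        unfolding L'_def using saturation_subset[OF IP adjoin_subset[OF II]] Ls(3)
          ideal.I_l_closed[OF II r xc] by blast
      then have "L' = I N" using L(2)[of L'] L' Ls xr unfolding F_def by blast
      then obtain s where s: "s \<in> carrier R - P" "s \<otimes> r \<in> adjoin R L (x \<otimes> r)"
        using r unfolding L'_def saturation_def by blast
      then obtain l a where la: "l \<in> L" "a \<in> carrier R" "s \<otimes> r = l \<oplus> a \<otimes> (x \<otimes> r)" by (elim adjoinE)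
      have lc: "l \<in> carrier R" using ideal.Icarr[OF LI la(1)] .
      have "(s \<ominus> a \<otimes> x) \<otimes> r = s \<otimes> r \<ominus> a \<otimes> (x \<otimes> r)"
        using s(1) la(2) xc rc by (simp add: a_minus_def l_distr l_minus m_assoc)
      also have "\<dots> = l" unfolding la(3) using la(2) xrc lc by (simp add: a_minus_def a_assoc r_neg)
      finally have *: "(s \<ominus> a \<otimes> x) \<otimes> r \<in> L" using la(1) by simp
      have ax: "a \<otimes> x \<in> P" using ideal.I_l_closed[OF PI x la(2)] .
      have "s \<ominus> a \<otimes> x \<notin> P"
      proof
        assume "s \<ominus> a \<otimes> x \<in> P"
        moreover have "(s \<ominus> a \<otimes> x) \<oplus> a \<otimes> x = s"
          using s(1) la(2) xc by (simp add: a_minus_def a_assoc l_neg)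
        ultimately show False using ideal_add[OF PI _ ax] s(1) by fastforce
      qed
      then have "r \<in> L" using saturatedD[OF Ls(1) _ rc *] s(1) la(2) xc by auto
      then show False using xr ideal.I_l_closed[OF LI _ xc] by blast
    qed
    have "I N \<subseteq> L"
    proof
      fix r assume r: "r \<in> I N"
      have rc: "r \<in> carrier R" using ideal.Icarr[OF II r] .
      obtain s where s: "s \<in> carrier R - P" "s \<otimes> r \<in> adjoin R (I (Suc N)) x"
        using r INH unfolding H_def saturation_def by blast
      then obtain t a where ta: "t \<in> I (Suc N)" "a \<in> carrier R" "s \<otimes> r = t \<oplus> a \<otimes> x" by (elim adjoinE)
      have "t \<oplus> a \<otimes> x \<in> I N" using ideal.I_l_closed[OF II r, of s] s(1) by (simp flip: ta(3))
      then have "a \<otimes> x \<in> I N" using ideal_add_cancel[OF II] Idec ta xc by blast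
      then have "x \<otimes> a \<in> I N" using ta(2) xc by (simp add: m_comm)
      \<comment> \<open>Here saturation at \<open>Q\<close> is essential, and saturation at
        \<open>P\<close> would not do: \<open>x\<close> lies in \<open>P\<close> but outside
        \<open>Q\<close>.\<close>
      then have "a \<in> I N" using saturatedD[OF IQ _ ta(2)] xc xQ by blast
      then have "a \<otimes> x \<in> L" using xL[of a] m_comm[OF ta(2) xc] by simp
      then have "s \<otimes> r \<in> L" unfolding ta(3) using ideal_add[OF LI] ta(1) Ls(2) by blast
      then show "r \<in> L" using saturatedD[OF Ls(1) s(1) rc] by blast
    qed
    then show False using Ls(3) by blast
  qed
  then have "y [^] N \<in> I (Suc N)" using Iy by blast
  then obtain s where s: "s \<in> carrier R - Q" "s \<otimes> y [^] N \<in> adjoin R Q0 (y [^] (Suc N))"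
    unfolding I_def saturation_def by blast
  then obtain q a where qa: "q \<in> Q0" "a \<in> carrier R" "s \<otimes> y [^] N = q \<oplus> a \<otimes> y [^] (Suc N)"
    by (elim adjoinE)
  have qc: "q \<in> carrier R" using ideal.Icarr[OF Q0I qa(1)] .
  have yN: "y [^] N \<in> carrier R" using yc by simp
  \<comment> \<open>Factor out \<open>y^N\<close> modulo \<open>Q0\<close>. As \<open>y\<close> is
    not in the prime \<open>Q0\<close>, the other factor \<open>s - a y\<close> is, and this puts
    \<open>s\<close> into \<open>Q\<close>.\<close>
  have "(s \<ominus> a \<otimes> y) \<otimes> y [^] N = s \<otimes> y [^] N \<ominus> a \<otimes> y [^] (Suc N)"
    using s(1) qa(2) yc by (simp add: a_minus_def l_distr l_minus m_assoc m_comm[of y])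
  also have "\<dots> = q" unfolding qa(3) using qa(2) yc qc by (simp add: a_minus_def a_assoc r_neg)
  finally have "(s \<ominus> a \<otimes> y) \<otimes> y [^] N \<in> Q0" using qa(1) by simp
  then have "s \<ominus> a \<otimes> y \<in> Q0 \<or> y [^] N \<in> Q0"
    using primeideal.I_prime[OF Q0, of "s \<ominus> a \<otimes> y" "y [^] N"] qa(2) s(1) yc by auto
  then have "s \<ominus> a \<otimes> y \<in> Q" using prime_power_mem[OF Q0 yc] y(2) sub(1) by blast
  moreover have "a \<otimes> y \<in> Q" using ideal.I_l_closed[OF QI y(1) qa(2)] .
  ultimately have "(s \<ominus> a \<otimes> y) \<oplus> a \<otimes> y \<in> Q" using ideal_add[OF QI] by blast
  moreover have "(s \<ominus> a \<otimes> y) \<oplus> a \<otimes> y = s"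
    using s(1) qa(2) yc by (simp add: a_minus_def a_assoc l_neg)
  ultimately show False using s(1) by simp
qed


text \<open>Induction on the length of the chain, dropping one generator together with the top
  prime. \<open>Q\<close> is a largest prime strictly below \<open>P\<close> and over
  \<open>C n\<close>. An \<open>x\<close> in \<open>S\<close> outside \<open>Q\<close> makes
  \<open>P\<close> the only prime over \<open>Q + Rx\<close> inside \<open>P\<close>, so the other
  generators can be moved into \<open>Q\<close> modulo \<open>x\<close>, up to powers and
  multipliers outside \<open>P\<close>.\<close>

theorem krull_height:
  assumes "primeideal P R" "finite S" "S \<subseteq> P"
    and "\<And>P'. primeideal P' R \<Longrightarrow> S \<subseteq> P' \<Longrightarrow> P' \<subseteq> P \<Longrightarrow> P' = P"
    and "\<And>i. i \<le> n \<Longrightarrow> primeideal (C i) R" "\<And>i. i < n \<Longrightarrow> C i \<subset> C (Suc i)" "C n \<subseteq> P"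
  shows "n \<le> card S"
  using assms
proof (induction n arbitrary: S P)
  case (Suc n)
  note P = Suc.prems(1) and S = Suc.prems(2,3) and min = Suc.prems(4) and C = Suc.prems(5-7)
  note PI = primeideal.axioms(1)[OF P]
  define F where "F = {Q. primeideal Q R \<and> C n \<subseteq> Q \<and> Q \<subset> P}"
  have "C n \<in> F" using C(1)[of n] C(2)[of n] C(3) by (auto simp: F_def)
  then have "F \<noteq> {}" by blast
  moreover have "ideal J R" if "J \<in> F" for J using that by (simp add: F_def primeideal.axioms(1))
  ultimately obtain Q where Q: "Q \<in> F" "\<And>N. N \<in> F \<Longrightarrow> Q \<subseteq> N \<Longrightarrow> N = Q"
    using maximal_ideal_exists[of F] by blast
  have Qp: "primeideal Q R" "C n \<subseteq> Q" "Q \<subset> P" using Q(1) by (auto simp: F_def)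
  note QI = primeideal.axioms(1)[OF Qp(1)]
  obtain x where x: "x \<in> S" "x \<notin> Q" using min[OF Qp(1)] Qp(3) by blast
  have xc: "x \<in> carrier R" using ideal.Icarr[OF PI] S x by blast
  have only: "P' = P" if "primeideal P' R" "adjoin R Q x \<subseteq> P'" "P' \<subseteq> P" for P'
  proof (rule ccontr)
    assume "P' \<noteq> P"
    moreover have "Q \<subseteq> P'" "x \<in> P'"
      using that adjoin_superset[OF QI xc] adjoin_self[OF QI xc] by auto
    ultimately have "P' = Q" using Q(2)[of P'] that Qp by (auto simp: F_def)
    then show False using x \<open>x \<in> P'\<close> by blast
  qed
  have "\<exists>q\<in>Q. \<exists>s\<in>carrier R - P. \<exists>a\<in>carrier R. \<exists>k::nat. s \<otimes> y [^] k = q \<oplus> a \<otimes> x" if y: "y \<in> S" for y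
  proof -
    have "y \<in> P" using y S by blast
    then obtain s and k :: nat where "s \<in> carrier R - P" "s \<otimes> y [^] k \<in> adjoin R Q x"
      using power_mem_of_minimal_prime[OF P adjoin_ideal[OF QI xc], of y] only by metis
    then show ?thesis unfolding adjoin_def by blast
  qed
  then obtain q where q: "\<And>y. y \<in> S \<Longrightarrow> q y \<in> Q"
    "\<And>y. y \<in> S \<Longrightarrow> \<exists>s\<in>carrier R - P. \<exists>a\<in>carrier R. \<exists>k::nat. s \<otimes> y [^] k = q y \<oplus> a \<otimes> x"
    by metis
  \<comment> \<open>A prime inside \<open>P\<close> that contains \<open>x\<close> and all
    \<open>q y\<close> contains some \<open>s y^k\<close> with \<open>s\<close> outside
    \<open>P\<close>, hence \<open>y\<close>. So for a prime \<open>P0\<close> over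
    \<open>S'\<close> inside \<open>Q\<close>, the prime \<open>P\<close> is minimal over
    \<open>P0 + Rx\<close>, and the principal ideal theorem forces \<open>Q = P0\<close>.\<close>
  define S' where "S' = q ` (S - {x})"
  have "n \<le> card S'"
  proof (rule Suc.IH[OF Qp(1)])
    show "finite S'" "S' \<subseteq> Q" using S q(1) by (auto simp: S'_def)
    show "primeideal (C i) R" if "i \<le> n" for i using C(1) that by simp
    show "C i \<subset> C (Suc i)" if "i < n" for i using C(2) that by simp
    show "C n \<subseteq> Q" by (rule Qp(2))
    fix P0 assume P0: "primeideal P0 R" "S' \<subseteq> P0" "P0 \<subseteq> Q"
    have "Q = P0"
    proof (rule krull_principal_ideal[OF P Qp(1) P0(1,3) Qp(3)])
      show "x \<in> P" using x S by blast
      fix P' assume P': "primeideal P' R" "P0 \<subseteq> P'" "x \<in> P'" "P' \<subseteq> P"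
      note P'I = primeideal.axioms(1)[OF P'(1)]
      have "S \<subseteq> P'"
      proof
        fix y assume y: "y \<in> S"
        have yc: "y \<in> carrier R" using ideal.Icarr[OF PI] S y by blast
        show "y \<in> P'"
        proof (cases "y = x")
          case False
          then have "q y \<in> P'" using y P0(2) P'(2) by (auto simp: S'_def)
          obtain s a and k :: nat where *: "s \<in> carrier R - P" "a \<in> carrier R"
            "s \<otimes> y [^] k = q y \<oplus> a \<otimes> x" using q(2)[OF y] by blast
          have "s \<otimes> y [^] k \<in> P'" unfolding *(3)
            using ideal_add[OF P'I \<open>q y \<in> P'\<close>] ideal.I_l_closed[OF P'I P'(3) *(2)] by blast
          then have "y [^] k \<in> P'"
            using primeideal.I_prime[OF P'(1), of s "y [^] k"] *(1) yc P'(4) by auto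
          then show ?thesis using prime_power_mem[OF P'(1) yc] by blast
        qed (use P' in simp)
      qed
      then show "P' = P" using min P' by blast
    qed
    then show "P0 = Q" by simp
  qed
  also have "card S' \<le> card (S - {x})" unfolding S'_def using S by (intro card_image_le) auto
  also have "Suc \<dots> = card S" using card_Suc_Diff1[OF S(1) x(1)] .
  finally show ?case by simp
qed simp

text \<open>Noetherian induction: if \<open>a b\<close> is in \<open>M\<close> and neither factor
  is, every prime over \<open>M\<close> lies over \<open>M + Ra\<close> or \<open>M + Rb\<close>, so
  the two finite sets combine. A finite set with a member below every prime over \<open>I\<close>
  serves in place of the set of minimal primes.\<close>

lemma finite_primes_over:
  assumes "ideal I R"
  shows "\<exists>F. finite F \<and> (\<forall>P\<in>F. primeideal P R \<and> I \<subseteq> P) \<and>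
    (\<forall>P. primeideal P R \<and> I \<subseteq> P \<longrightarrow> (\<exists>Q\<in>F. Q \<subseteq> P))"
proof -
  define D where "D = (\<lambda>I. \<exists>F. finite F \<and> (\<forall>P\<in>F. primeideal P R \<and> I \<subseteq> P) \<and>
    (\<forall>P. primeideal P R \<and> I \<subseteq> P \<longrightarrow> (\<exists>Q\<in>F. Q \<subseteq> P)))"
  define S where "S = {I. ideal I R \<and> \<not> D I}"
  have "S = {}"
  proof (rule ccontr)
    assume "S \<noteq> {}"
    then obtain M where M: "M \<in> S" "\<And>N. N \<in> S \<Longrightarrow> M \<subseteq> N \<Longrightarrow> N = M"
      using maximal_ideal_exists[of S] unfolding S_def by blast
    have MI: "ideal M R" and MD: "\<not> D M" using M(1) by (auto simp: S_def)
    have "M \<noteq> carrier R"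
    proof
      assume "M = carrier R"
      then have "\<not> (primeideal P R \<and> M \<subseteq> P)" for P
        using prime_one_notin[of P] by blast
      then have "D M" unfolding D_def by blast
      then show False using MD by blast
    qed
    moreover have "\<not> primeideal M R"
    proof
      assume "primeideal M R"
      then have "D M" unfolding D_def by (intro exI[of _ "{M}"]) auto
      then show False using MD by blast
    qed
    ultimately obtain a b where ab: "a \<in> carrier R" "b \<in> carrier R" "a \<otimes> b \<in> M" "a \<notin> M" "b \<notin> M"
      using ideal.primeidealCD[OF MI is_cring] by blast
    have D: "D (adjoin R M c)" if "c \<in> carrier R" "c \<notin> M" for c
      using M(2)[of "adjoin R M c"] adjoin_ideal[OF MI that(1)] adjoin_superset[OF MI that(1)]
        adjoin_self[OF MI that(1)] that(2) by (auto simp: S_def)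
    from D[OF ab(1,4)] obtain F where F: "finite F" "\<forall>P\<in>F. primeideal P R \<and> adjoin R M a \<subseteq> P"
      "\<forall>P. primeideal P R \<and> adjoin R M a \<subseteq> P \<longrightarrow> (\<exists>Q\<in>F. Q \<subseteq> P)" unfolding D_def by blast
    from D[OF ab(2,5)] obtain G where G: "finite G" "\<forall>P\<in>G. primeideal P R \<and> adjoin R M b \<subseteq> P"
      "\<forall>P. primeideal P R \<and> adjoin R M b \<subseteq> P \<longrightarrow> (\<exists>Q\<in>G. Q \<subseteq> P)" unfolding D_def by blast
    have "\<forall>P\<in>F \<union> G. primeideal P R \<and> M \<subseteq> P"
      using F(2) G(2) adjoin_superset[OF MI ab(1)] adjoin_superset[OF MI ab(2)] by blast
    moreover have "\<exists>Q\<in>F \<union> G. Q \<subseteq> P" if P: "primeideal P R" "M \<subseteq> P" for P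
    proof -
      note PI = primeideal.axioms(1)[OF P(1)]
      have "a \<in> P \<or> b \<in> P" using primeideal.I_prime[OF P(1) ab(1,2)] ab(3) P(2) by blast
      then have "adjoin R M a \<subseteq> P \<or> adjoin R M b \<subseteq> P" using adjoin_subset[OF PI P(2)] by blast
      then show ?thesis using F(3) G(3) P(1) by (meson UnCI)
    qed
    ultimately have "D M" unfolding D_def using F(1) G(1) by (intro exI[of _ "F \<union> G"]) simp
    then show False using MD by blast
  qed
  then have "D I" using assms by (auto simp: S_def)
  then show ?thesis by (simp only: D_def)
qed

end

section \<open>Prime avoidance\<close>

context cring
begin

text \<open>Multiply an element of \<open>J\<close> outside \<open>P\<close> by one from each
  \<open>Q\<close> outside \<open>P\<close>; primality keeps the product outside \<open>P\<close>.
  This supplies the correction term in prime avoidance.\<close>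

lemma exists_common_nonmember:
  assumes "primeideal P R" "finite G" "\<And>Q. Q \<in> G \<Longrightarrow> ideal Q R \<and> \<not> Q \<subseteq> P"
    and "ideal J R" "\<not> J \<subseteq> P"
  shows "\<exists>y\<in>J. y \<notin> P \<and> (\<forall>Q\<in>G. y \<in> Q)"
  using assms(2,3)
proof (induction G)
  case empty
  then show ?case using assms(5) by blast
next
  case (insert Q G)
  then obtain y where y: "y \<in> J" "y \<notin> P" "\<forall>Q\<in>G. y \<in> Q" by blast
  obtain z where z: "z \<in> Q" "z \<notin> P" using insert.prems[of Q] by blast
  have I: "ideal Q R" using insert.prems[of Q] by blast
  have c: "y \<in> carrier R" "z \<in> carrier R" using ideal.Icarr[OF assms(4) y(1)] ideal.Icarr[OF I z(1)] .
  have "y \<otimes> z \<in> Q'" if "Q' \<in> G" for Q'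
    using ideal.I_r_closed[of Q' R y z] insert.prems[of Q'] that y(3) c by blast
  moreover have "y \<otimes> z \<in> J" "y \<otimes> z \<in> Q"
    using ideal.I_r_closed[OF assms(4) y(1) c(2)] ideal.I_l_closed[OF I z(1) c(1)] .
  moreover have "y \<otimes> z \<notin> P" using primeideal.I_prime[OF assms(1) c] y z by blast
  ultimately show ?case by blast
qed

text \<open>Induction on the set of primes. If one member contains another, the smaller one may be
  dropped. In an antichain, an element that avoids all members but \<open>P\<close> and lies in
  \<open>P\<close> is corrected by adding an element of \<open>J\<close> that lies in all the others
  and not in \<open>P\<close>.\<close>

lemma prime_avoidance:
  assumes "finite F" and J: "ideal J R" and "\<And>P. P \<in> F \<Longrightarrow> primeideal P R \<and> \<not> J \<subseteq> P"
  shows "\<exists>x\<in>J. \<forall>P\<in>F. x \<notin> P"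
  using assms(1,3)
proof (induction F rule: finite_psubset_induct)
  case (psubset F)
  show ?case
  proof (cases "\<exists>P\<in>F. \<exists>Q\<in>F. Q \<subset> P")
    case True
    then obtain P Q where PQ: "P \<in> F" "Q \<in> F" "Q \<subset> P" by blast
    then have "\<exists>x\<in>J. \<forall>P\<in>F - {Q}. x \<notin> P" using psubset.prems by (intro psubset.IH) auto
    then obtain x where x: "x \<in> J" "\<forall>P\<in>F - {Q}. x \<notin> P" by blast
    then have "x \<notin> P" using PQ by blast
    then show ?thesis using x PQ(3) by blast
  next
    case antichain: False
    show ?thesis
    proof (cases "F = {}")
      case True
      then show ?thesis using ideal_zero[OF J] by blast
    next
      case False
      then obtain P where P: "P \<in> F" by blast
      then have "\<exists>x\<in>J. \<forall>Q\<in>F - {P}. x \<notin> Q" using psubset.prems by (intro psubset.IH) auto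
      then obtain x where x: "x \<in> J" "\<forall>Q\<in>F - {P}. x \<notin> Q" by blast
      show ?thesis
      proof (cases "x \<in> P")
        case True
        have Pp: "primeideal P R" "\<not> J \<subseteq> P" using psubset.prems[OF P] by auto
        have "ideal Q R \<and> \<not> Q \<subseteq> P" if "Q \<in> F - {P}" for Q
          using psubset.prems[of Q] that antichain P by (auto intro: primeideal.axioms(1))
        then obtain y where y: "y \<in> J" "y \<notin> P" "\<forall>Q\<in>F - {P}. y \<in> Q"
          using exists_common_nonmember[OF Pp(1) _ _ J Pp(2), of "F - {P}"] psubset.hyps(1) by auto
        have c: "x \<in> carrier R" "y \<in> carrier R" using ideal.Icarr[OF J] x y by auto
        have "x \<oplus> y \<notin> Q" if Q: "Q \<in> F" for Q
        proof
          assume xy: "x \<oplus> y \<in> Q"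
          have QI: "ideal Q R" using psubset.prems[OF Q] primeideal.axioms(1) by blast
          show False
          proof (cases "Q = P")
            case True
            then show False using ideal_add_cancel[OF QI _ c(2) xy] \<open>x \<in> P\<close> y(2) by blast
          next
            case False
            then show False
              using ideal_add_cancel[OF QI _ c(1), of y] xy x y Q a_comm[OF c] by auto
          qed
        qed
        moreover have "x \<oplus> y \<in> J" using ideal_add[OF J] x(1) y(1) .
        ultimately show ?thesis by blast
      next
        case False
        then show ?thesis using x by blast
      qed
    qed
  qed
qed

end

section \<open>Systems of parameters\<close>

locale noetherian_local_ring = noetherian_cring +
  fixes \<mm>
  assumes maximal: "maximalideal \<mm> R" and unique: "\<And>P. maximalideal P R \<Longrightarrow> P = \<mm>"
begin

lemma max_ideal_eq: "max_ideal R = \<mm>"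
  unfolding max_ideal_def using maximal unique by (rule the_equality)

lemma max_ideal_ideal: "ideal \<mm> R"
  using maximal by (rule maximalideal.axioms(1))

lemma max_ideal_prime: "primeideal \<mm> R"
  using maximal by (rule maximalideal_prime)

lemma proper_ideal_subset:
  assumes "ideal I R" "I \<noteq> carrier R"
  shows "I \<subseteq> \<mm>"
proof -
  define F where "F = {J. ideal J R \<and> I \<subseteq> J \<and> J \<noteq> carrier R}"
  have "F \<noteq> {}" using assms unfolding F_def by blast
  moreover have "ideal J R" if "J \<in> F" for J using that by (simp add: F_def)
  ultimately obtain M where M: "M \<in> F" "\<And>N. N \<in> F \<Longrightarrow> M \<subseteq> N \<Longrightarrow> N = M"
    using maximal_ideal_exists[of F] by blast
  have "maximalideal M R"
  proof (rule maximalidealI)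
    fix J assume "ideal J R" "M \<subseteq> J" "J \<subseteq> carrier R"
    then show "J = M \<or> J = carrier R" using M(2)[of J] M(1) by (auto simp: F_def)
  qed (use M(1) in \<open>auto simp: F_def\<close>)
  then show ?thesis using unique M(1) by (auto simp: F_def)
qed

lemma prime_subset: "primeideal P R \<Longrightarrow> P \<subseteq> \<mm>"
  using proper_ideal_subset[OF primeideal.axioms(1)] primeideal.I_notcarr by metis

text \<open>The maximal ideal is finitely generated, and the height theorem bounds every chain of
  primes by the number of its generators.\<close>

lemma krull_dim_finite: "krull_dim R \<noteq> \<infinity>"
proof -
  obtain A where A: "A \<subseteq> carrier R" "finite A" "\<mm> = Idl A"
    using finetely_gen[OF max_ideal_ideal] by blast
  have "krull_dim R \<le> enat (card A)"
    unfolding krull_dim_def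
  proof (rule Sup_least, clarify)
    fix n C assume C: "\<forall>i\<le>n. primeideal (C i) R" "\<forall>i<n. C i \<subset> C (Suc i)"
    have "n \<le> card A"
    proof (rule krull_height[OF max_ideal_prime A(2)])
      show "A \<subseteq> \<mm>" using genideal_self[OF A(1)] A(3) by simp
      show "P' = \<mm>" if "primeideal P' R" "A \<subseteq> P'" "P' \<subseteq> \<mm>" for P'
        using genideal_minimal[OF primeideal.axioms(1)[OF that(1)] that(2)] that(3) A(3) by blast
      show "C n \<subseteq> \<mm>" using C(1) prime_subset by blast
    qed (use C in auto)
    then show "enat n \<le> enat (card A)" by simp
  qed
  then show ?thesis by (auto dest: enat_ile)
qed

text \<open>Each parameter is chosen outside the finitely many primes found over the previous ones,
  the maximal ideal excepted. After \<open>i\<close> choices every prime over them tops a chain of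
  length \<open>i\<close>; after \<open>d\<close> choices, a prime strictly below the maximal ideal
  would give a chain longer than the dimension.\<close>

lemma exists_parameters:
  obtains xs where "set xs \<subseteq> \<mm>" "enat (length xs) = krull_dim R"
    "\<And>P. primeideal P R \<Longrightarrow> set xs \<subseteq> P \<Longrightarrow> P = \<mm>"
proof -
  define chain where "chain = (\<lambda>n P. \<exists>C. (\<forall>i\<le>n. primeideal (C i) R) \<and> (\<forall>i<n. C i \<subset> C (Suc i)) \<and> C n = P)"
  have extend: "chain (Suc n) P" if C0: "chain n Q" and "Q \<subset> P" "primeideal P R" for n P Q
  proof -
    obtain C where C: "\<forall>i\<le>n. primeideal (C i) R" "\<forall>i<n. C i \<subset> C (Suc i)" "C n = Q"
      using C0 unfolding chain_def by blast
    have "\<forall>i<Suc n. (C(Suc n := P)) i \<subset> (C(Suc n := P)) (Suc i)"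
      using C(2,3) \<open>Q \<subset> P\<close> by (auto simp: less_Suc_eq)
    then show ?thesis
      using C(1) \<open>primeideal P R\<close> unfolding chain_def by (intro exI[of _ "C(Suc n := P)"]) (auto simp: le_Suc_eq)
  qed
  obtain d where d: "krull_dim R = enat d" using krull_dim_finite by auto
  have below: "n \<le> d" if "chain n P" for n P
  proof -
    have "enat n \<le> krull_dim R"
      unfolding krull_dim_def using that unfolding chain_def by (intro Sup_upper imageI) blast
    then show ?thesis by (simp add: d)
  qed
  \<comment> \<open>The maximal ideal cannot be avoided, since the parameters lie in it. If it is
    among the primes found, the required chain comes from the dimension instead: cut a longer chain
    after \<open>C i\<close> and put the maximal ideal on top.\<close>
  have chain_max: "chain (Suc i) \<mm>" if "i < d" for i
  proof -
    have "enat i < krull_dim R" using that by (simp add: d)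
    then obtain n C where n: "i < n" and C: "\<forall>i\<le>n. primeideal (C i) R" "\<forall>i<n. C i \<subset> C (Suc i)"
      unfolding krull_dim_def less_Sup_iff by auto
    have "chain i (C i)" unfolding chain_def using C n by (intro exI[of _ C]) auto
    moreover have "C i \<subset> \<mm>" using C n prime_subset[of "C (Suc i)"] by (metis Suc_leI psubset_subset_trans)
    ultimately show ?thesis using extend max_ideal_prime by blast
  qed
  have "\<exists>xs. length xs = i \<and> set xs \<subseteq> \<mm> \<and> (\<forall>P. primeideal P R \<and> set xs \<subseteq> P \<longrightarrow> chain i P)" if "i \<le> d" for i
    using that
  proof (induction i)
    case 0
    have "chain 0 P" if "primeideal P R" for P
      unfolding chain_def using that by (intro exI[of _ "\<lambda>_. P"]) auto
    then show ?case by (intro exI[of _ "[]"]) auto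
  next
    case (Suc i)
    then obtain xs where xs: "length xs = i" "set xs \<subseteq> \<mm>"
      "\<And>P. primeideal P R \<Longrightarrow> set xs \<subseteq> P \<Longrightarrow> chain i P" by auto
    have xsc: "set xs \<subseteq> carrier R" using xs(2) ideal.Icarr[OF max_ideal_ideal] by blast
    obtain F where F: "finite F" "\<forall>P\<in>F. primeideal P R \<and> Idl (set xs) \<subseteq> P"
      "\<forall>P. primeideal P R \<and> Idl (set xs) \<subseteq> P \<longrightarrow> (\<exists>Q\<in>F. Q \<subseteq> P)"
      using finite_primes_over[OF genideal_ideal[OF xsc]] by blast
    have "primeideal P R \<and> \<not> \<mm> \<subseteq> P" if "P \<in> F - {\<mm>}" for P
      using that F(2) prime_subset[of P] by blast
    then have "\<exists>x\<in>\<mm>. \<forall>P\<in>F - {\<mm>}. x \<notin> P"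
      using prime_avoidance[OF _ max_ideal_ideal, of "F - {\<mm>}"] F(1) by blast
    then obtain x where x: "x \<in> \<mm>" "\<forall>P\<in>F - {\<mm>}. x \<notin> P" by blast
    have "chain (Suc i) P" if P: "primeideal P R" "set (x # xs) \<subseteq> P" for P
    proof -
      have "Idl (set xs) \<subseteq> P" using genideal_minimal[OF primeideal.axioms(1)[OF P(1)]] P(2) by simp
      then obtain Q where Q: "Q \<in> F" "Q \<subseteq> P" using F(3) P(1) by blast
      show ?thesis
      proof (cases "Q = \<mm>")
        case True
        then have "P = \<mm>" using Q prime_subset[OF P(1)] by blast
        then show ?thesis using chain_max Suc.prems by simp
      next
        case False
        then have "Q \<subset> P" using x Q P(2) by auto
        moreover have "chain i Q" using xs(3) F(2) Q(1) genideal_self[OF xsc] by blast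
        ultimately show ?thesis using extend P(1) by blast
      qed
    qed
    then show ?case using xs x by (intro exI[of _ "x # xs"]) auto
  qed
  from this[OF order_refl] obtain xs where xs: "length xs = d" "set xs \<subseteq> \<mm>"
    "\<And>P. primeideal P R \<Longrightarrow> set xs \<subseteq> P \<Longrightarrow> chain d P" by auto
  have "P = \<mm>" if "primeideal P R" "set xs \<subseteq> P" for P
  proof (rule ccontr)
    assume "P \<noteq> \<mm>"
    then have "P \<subset> \<mm>" using prime_subset[OF that(1)] by blast
    then have "chain (Suc d) \<mm>" using extend xs(3)[OF that] max_ideal_prime by blast
    then show False using below by fastforce
  qed
  then show ?thesis using that xs d by auto
qed

text \<open>If no power of \<open>r\<close> were in the ideal, some prime over the ideal would miss
  \<open>r\<close>; but the only prime over it is the maximal ideal. Testing parameters by primes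
  makes it immediate that \<open>y\<close> may be replaced by its square.\<close>

lemma system_of_parametersI:
  assumes "set xs \<subseteq> \<mm>" "enat (length xs) = krull_dim R"
    and "\<And>P. primeideal P R \<Longrightarrow> set xs \<subseteq> P \<Longrightarrow> P = \<mm>"
  shows "system_of_parameters R xs"
proof -
  have c: "set xs \<subseteq> carrier R" using assms(1) ideal.Icarr[OF max_ideal_ideal] by blast
  have "radical R (Idl (set xs)) = \<mm>"
  proof
    show "radical R (Idl (set xs)) \<subseteq> \<mm>"
      using genideal_minimal[OF max_ideal_ideal assms(1)] prime_power_mem[OF max_ideal_prime]
      by (auto simp: radical_def)
    show "\<mm> \<subseteq> radical R (Idl (set xs))"
    proof
      fix r assume r: "r \<in> \<mm>"
      have rc: "r \<in> carrier R" using ideal.Icarr[OF max_ideal_ideal r] .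
      define S where "S = range (\<lambda>k::nat. r [^] k)"
      have "Idl (set xs) \<inter> S \<noteq> {}"
      proof
        assume "Idl (set xs) \<inter> S = {}"
        moreover have "S \<subseteq> carrier R" using rc by (auto simp: S_def)
        moreover have "\<one> \<in> S" unfolding S_def by (rule range_eqI[of _ _ 0]) simp
        moreover have "a \<otimes> b \<in> S" if "a \<in> S" "b \<in> S" for a b
          using that rc by (auto simp: S_def nat_pow_mult)
        ultimately obtain P where P: "primeideal P R" "Idl (set xs) \<subseteq> P" "P \<inter> S = {}"
          using exists_prime_disjoint[OF genideal_ideal[OF c], of S] by blast
        have "r \<in> P" using assms(3)[OF P(1)] genideal_self[OF c] P(2) r by blast
        moreover have "r \<in> S" unfolding S_def using rc by (intro range_eqI[of _ _ 1]) simp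
        ultimately show False using P(3) by blast
      qed
      then show "r \<in> radical R (Idl (set xs))" using rc by (auto simp: radical_def S_def)
    qed
  qed
  then show ?thesis using c assms(2) by (simp add: system_of_parameters_def max_ideal_eq)
qed

end


section \<open>Dietz closures and direct sums of two cyclic modules\<close>

text \<open>\<open>cyclic_sum R I J W e\<close>: the module \<open>W\<close> is a copy of \<open>R/I \<oplus> R/J\<close>, with \<open>e a b\<close> the
  class of \<open>(a, b)\<close>.\<close>

definition cyclic_sum ::
    "('a, 'm) ring_scheme \<Rightarrow> 'a set \<Rightarrow> 'a set \<Rightarrow> ('a, 'b) module \<Rightarrow> ('a \<Rightarrow> 'a \<Rightarrow> 'b) \<Rightarrow> bool" where
  "cyclic_sum R I J W e \<longleftrightarrow> module R W \<and> ideal I R \<and> ideal J R \<and>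
     (\<forall>a\<in>carrier R. \<forall>b\<in>carrier R. e a b \<in> carrier W) \<and>
     (\<forall>w\<in>carrier W. \<exists>a\<in>carrier R. \<exists>b\<in>carrier R. w = e a b) \<and>
     (\<forall>a\<in>carrier R. \<forall>b\<in>carrier R. \<forall>c\<in>carrier R. \<forall>d\<in>carrier R.
        e a b \<oplus>\<^bsub>W\<^esub> e c d = e (a \<oplus>\<^bsub>R\<^esub> c) (b \<oplus>\<^bsub>R\<^esub> d)) \<and>
     (\<forall>r\<in>carrier R. \<forall>a\<in>carrier R. \<forall>b\<in>carrier R. r \<odot>\<^bsub>W\<^esub> e a b = e (r \<otimes>\<^bsub>R\<^esub> a) (r \<otimes>\<^bsub>R\<^esub> b)) \<and>
     (\<forall>a\<in>carrier R. \<forall>b\<in>carrier R. \<forall>c\<in>carrier R. \<forall>d\<in>carrier R.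
        e a b = e c d \<longleftrightarrow> a \<ominus>\<^bsub>R\<^esub> c \<in> I \<and> b \<ominus>\<^bsub>R\<^esub> d \<in> J)"

lemma cyclic_sumD:
  assumes "cyclic_sum R I J W e"
  shows "module R W" "ideal I R" "ideal J R"
    and "\<And>a b. a \<in> carrier R \<Longrightarrow> b \<in> carrier R \<Longrightarrow> e a b \<in> carrier W"
    and "\<And>w. w \<in> carrier W \<Longrightarrow> \<exists>a\<in>carrier R. \<exists>b\<in>carrier R. w = e a b"
    and "\<And>a b c d. a \<in> carrier R \<Longrightarrow> b \<in> carrier R \<Longrightarrow> c \<in> carrier R \<Longrightarrow> d \<in> carrier R \<Longrightarrow>
        e a b \<oplus>\<^bsub>W\<^esub> e c d = e (a \<oplus>\<^bsub>R\<^esub> c) (b \<oplus>\<^bsub>R\<^esub> d)"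
    and "\<And>r a b. r \<in> carrier R \<Longrightarrow> a \<in> carrier R \<Longrightarrow> b \<in> carrier R \<Longrightarrow>
        r \<odot>\<^bsub>W\<^esub> e a b = e (r \<otimes>\<^bsub>R\<^esub> a) (r \<otimes>\<^bsub>R\<^esub> b)"
    and "\<And>a b c d. a \<in> carrier R \<Longrightarrow> b \<in> carrier R \<Longrightarrow> c \<in> carrier R \<Longrightarrow> d \<in> carrier R \<Longrightarrow>
        e a b = e c d \<longleftrightarrow> a \<ominus>\<^bsub>R\<^esub> c \<in> I \<and> b \<ominus>\<^bsub>R\<^esub> d \<in> J"
  using assms unfolding cyclic_sum_def by simp_all

lemma fg_moduleI:
  assumes "module R W" and u: "u \<in> carrier W" and v: "v \<in> carrier W"
    and gen: "\<And>w. w \<in> carrier W \<Longrightarrow> \<exists>a\<in>carrier R. \<exists>b\<in>carrier R. w = a \<odot>\<^bsub>W\<^esub> u \<oplus>\<^bsub>W\<^esub> b \<odot>\<^bsub>W\<^esub> v"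
  shows "fg_module R W"
proof -
  interpret module R W by (rule assms(1))
  have "\<exists>c\<in>{u, v} \<rightarrow> carrier R. w = (\<Oplus>\<^bsub>W\<^esub>a\<in>{u, v}. c a \<odot>\<^bsub>W\<^esub> a)" if w: "w \<in> carrier W" for w
  proof -
    obtain a b where ab: "a \<in> carrier R" "b \<in> carrier R" "w = a \<odot>\<^bsub>W\<^esub> u \<oplus>\<^bsub>W\<^esub> b \<odot>\<^bsub>W\<^esub> v"
      using gen[OF w] by blast
    show ?thesis
    \<comment> \<open>If \<open>u = v\<close>, the set \<open>{u, v}\<close> has a single element,
      and both coefficients must be put on it.\<close>
    proof (cases "u = v")
      case True
      have "w = (\<Oplus>\<^bsub>W\<^esub>x\<in>{u, v}. (a \<oplus>\<^bsub>R\<^esub> b) \<odot>\<^bsub>W\<^esub> x)"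
        using ab u v True by (simp add: smult_l_distr)
      then show ?thesis using ab by (intro bexI[of _ "\<lambda>_. a \<oplus>\<^bsub>R\<^esub> b"]) auto
    next
      case False
      have "w = (\<Oplus>\<^bsub>W\<^esub>x\<in>{u, v}. (if x = u then a else b) \<odot>\<^bsub>W\<^esub> x)"
        using ab u v False by (simp add: Pi_def)
      then show ?thesis using ab by (intro bexI[of _ "\<lambda>x. if x = u then a else b"]) auto
    qed
  qed
  then show ?thesis unfolding fg_module_def using assms(1) u v by (intro conjI exI[of _ "{u, v}"]) auto
qed

context cring
begin

lemma cyclic_sum_fg:
  assumes "cyclic_sum R I J W e" shows "fg_module R W"
proof (rule fg_moduleI)
  note D = cyclic_sumD[OF assms]
  show "module R W" by (rule D)
  show "e \<one> \<zero> \<in> carrier W" "e \<zero> \<one> \<in> carrier W" using D(4) by simp_all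
  fix w assume "w \<in> carrier W"
  then obtain a b where "a \<in> carrier R" "b \<in> carrier R" "w = e a b" using D(5) by blast
  then have "w = a \<odot>\<^bsub>W\<^esub> e \<one> \<zero> \<oplus>\<^bsub>W\<^esub> b \<odot>\<^bsub>W\<^esub> e \<zero> \<one>" by (simp add: D(6,7))
  then show "\<exists>a\<in>carrier R. \<exists>b\<in>carrier R. w = a \<odot>\<^bsub>W\<^esub> e \<one> \<zero> \<oplus>\<^bsub>W\<^esub> b \<odot>\<^bsub>W\<^esub> e \<zero> \<one>"
    using \<open>a \<in> carrier R\<close> \<open>b \<in> carrier R\<close> by blast
qed

lemma cyclic_sum_zero:
  assumes "cyclic_sum R I J W e" shows "e \<zero> \<zero> = \<zero>\<^bsub>W\<^esub>"
proof -
  note D = cyclic_sumD[OF assms]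
  interpret W: module R W by (rule D)
  have "\<zero> \<odot>\<^bsub>W\<^esub> e \<zero> \<zero> = e \<zero> \<zero>" using D(7)[of \<zero> \<zero> \<zero>] by simp
  then show ?thesis using D(4)[of \<zero> \<zero>] by simp
qed

lemma cyclic_sum_transport:
  assumes C: "cyclic_sum R I J M e" and W: "module R W" and g: "g \<in> module_iso R M W"
  shows "cyclic_sum R I J W (\<lambda>a b. g (e a b))"
proof -
  note D = cyclic_sumD[OF C]
  have bij: "bij_betw g (carrier M) (carrier W)" and hom: "g \<in> module_hom R M W"
    using g by (auto simp: module_iso_def)
  have add: "g x \<oplus>\<^bsub>W\<^esub> g y = g (x \<oplus>\<^bsub>M\<^esub> y)" if "x \<in> carrier M" "y \<in> carrier M" for x y
    using hom that by (auto simp: module_hom_def)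
  have smult: "r \<odot>\<^bsub>W\<^esub> g x = g (r \<odot>\<^bsub>M\<^esub> x)" if "r \<in> carrier R" "x \<in> carrier M" for r x
    using hom that by (auto simp: module_hom_def)
  have inj: "g x = g y \<longleftrightarrow> x = y" if "x \<in> carrier M" "y \<in> carrier M" for x y
    using bij that by (auto simp: bij_betw_def dest: inj_onD)
  have surj: "\<exists>a\<in>carrier R. \<exists>b\<in>carrier R. w = g (e a b)" if "w \<in> carrier W" for w
    using bij that D(5) unfolding bij_betw_def by (metis imageE)
  have clos: "g x \<in> carrier W" if "x \<in> carrier M" for x
    using bij that by (auto simp: bij_betw_def)
  show ?thesis
    unfolding cyclic_sum_def using W D(2,3) surj by (simp add: add smult inj clos D(4,6,7,8))
qed

text \<open>The sum is first built on pairs of cosets, whose type need not be \<open>'c\<close>, and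
  then copied along the injection that \<open>large\<close> provides.\<close>

lemma cyclic_sum_exists:
  assumes I: "ideal I R" and J: "ideal J R" and large: "large_universe R TYPE('c)"
  obtains W :: "('a, 'c) module" and e where "cyclic_sum R I J W e"
proof -
  define M :: "('a, 'a set \<times> 'a set) module" where
    "M = \<lparr>carrier = {(I +> a, J +> b) | a b. a \<in> carrier R \<and> b \<in> carrier R},
      monoid.mult = undefined, one = undefined, ring.zero = (I +> \<zero>, J +> \<zero>),
      ring.add = (\<lambda>p q. (set_add R (fst p) (fst q), set_add R (snd p) (snd q))),
      smult = (\<lambda>r p. (rcoset_mult R I (I +> r) (fst p), rcoset_mult R J (J +> r) (snd p)))\<rparr>"
  define e where "e = (\<lambda>a b. (I +> a, J +> b))"
  have carr: "w \<in> carrier M \<longleftrightarrow> (\<exists>a\<in>carrier R. \<exists>b\<in>carrier R. w = e a b)" for w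
    by (auto simp: M_def e_def)
  have eM: "e a b \<in> carrier M" if "a \<in> carrier R" "b \<in> carrier R" for a b
    using that carr by blast
  have add: "e a b \<oplus>\<^bsub>M\<^esub> e c d = e (a \<oplus> c) (b \<oplus> d)"
    if "a \<in> carrier R" "b \<in> carrier R" "c \<in> carrier R" "d \<in> carrier R" for a b c d
    using that by (simp add: M_def e_def ideal.a_rcos_sum[OF I] ideal.a_rcos_sum[OF J])
  have smult: "r \<odot>\<^bsub>M\<^esub> e a b = e (r \<otimes> a) (r \<otimes> b)"
    if "a \<in> carrier R" "b \<in> carrier R" "r \<in> carrier R" for a b r
    using that by (simp add: M_def e_def ideal.rcoset_mult_add[OF I] ideal.rcoset_mult_add[OF J])
  have zero: "\<zero>\<^bsub>M\<^esub> = e \<zero> \<zero>" by (simp add: M_def e_def)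
  have "abelian_group M"
  proof (rule abelian_groupI)
    show "\<exists>y\<in>carrier M. y \<oplus>\<^bsub>M\<^esub> x = \<zero>\<^bsub>M\<^esub>" if x: "x \<in> carrier M" for x
    proof -
      obtain a b where ab: "a \<in> carrier R" "b \<in> carrier R" "x = e a b" using x carr by blast
      then have "e (\<ominus> a) (\<ominus> b) \<oplus>\<^bsub>M\<^esub> x = \<zero>\<^bsub>M\<^esub>" by (simp add: add zero l_neg)
      then show ?thesis using eM ab by (meson a_inv_closed)
    qed
    show "x \<oplus>\<^bsub>M\<^esub> y = y \<oplus>\<^bsub>M\<^esub> x" "x \<oplus>\<^bsub>M\<^esub> y \<in> carrier M"
      if "x \<in> carrier M" "y \<in> carrier M" for x y
      using that[unfolded carr] by (elim bexE; simp add: add eM a_comm)+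
    show "x \<oplus>\<^bsub>M\<^esub> y \<oplus>\<^bsub>M\<^esub> z = x \<oplus>\<^bsub>M\<^esub> (y \<oplus>\<^bsub>M\<^esub> z)"
      if "x \<in> carrier M" "y \<in> carrier M" "z \<in> carrier M" for x y z
      using that[unfolded carr] by (elim bexE; simp add: add a_assoc)
    show "\<zero>\<^bsub>M\<^esub> \<oplus>\<^bsub>M\<^esub> x = x" if x: "x \<in> carrier M" for x
    proof -
      obtain a b where ab: "a \<in> carrier R" "b \<in> carrier R" "x = e a b" using x carr by blast
      have "e \<zero> \<zero> \<oplus>\<^bsub>M\<^esub> e a b = e a b" using ab(1,2) by (simp add: add)
      then show ?thesis unfolding ab(3) zero .
    qed
    show "\<zero>\<^bsub>M\<^esub> \<in> carrier M" using eM[OF zero_closed zero_closed] unfolding zero .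
  qed
  then have module: "module R M"
  proof (rule moduleI[OF is_cring])
    show "r \<odot>\<^bsub>M\<^esub> x \<in> carrier M" if "r \<in> carrier R" "x \<in> carrier M" for r x
      using that(1) that(2)[unfolded carr] by (elim bexE; simp add: smult eM)
    show "(r \<oplus> s) \<odot>\<^bsub>M\<^esub> x = r \<odot>\<^bsub>M\<^esub> x \<oplus>\<^bsub>M\<^esub> s \<odot>\<^bsub>M\<^esub> x" "(r \<otimes> s) \<odot>\<^bsub>M\<^esub> x = r \<odot>\<^bsub>M\<^esub> (s \<odot>\<^bsub>M\<^esub> x)"
      if "r \<in> carrier R" "s \<in> carrier R" "x \<in> carrier M" for r s x
      using that(1,2) that(3)[unfolded carr] by (elim bexE; simp add: smult add l_distr m_assoc)+
    show "r \<odot>\<^bsub>M\<^esub> (x \<oplus>\<^bsub>M\<^esub> y) = r \<odot>\<^bsub>M\<^esub> x \<oplus>\<^bsub>M\<^esub> r \<odot>\<^bsub>M\<^esub> y"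
      if "r \<in> carrier R" "x \<in> carrier M" "y \<in> carrier M" for r x y
      using that(1) that(2,3)[unfolded carr] by (elim bexE; simp add: smult add r_distr)
    show "\<one> \<odot>\<^bsub>M\<^esub> x = x" if "x \<in> carrier M" for x
      using that[unfolded carr] by (elim bexE; simp add: smult)
  qed
  have "cyclic_sum R I J M e"
    unfolding cyclic_sum_def using module I J carr[THEN iffD1]
    by (simp add: add smult eM) (simp add: e_def quotient_eq_iff_same_a_r_cos)
  moreover from cyclic_sum_fg[OF this] obtain W :: "('a, 'c) module" and g
    where "module R W" "g \<in> module_iso R M W" using fg_module_copy[OF _ large] by blast
  ultimately show ?thesis using cyclic_sum_transport that by blast
qed

text \<open>The universal property of the sum: a map may be prescribed on representatives, and
  \<open>wd\<close> makes their choice irrelevant.\<close>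

lemma cyclic_sum_hom:
  assumes C: "cyclic_sum R I J W e"
    and F: "\<And>a b. a \<in> carrier R \<Longrightarrow> b \<in> carrier R \<Longrightarrow> F a b \<in> carrier V"
    and add: "\<And>a b c d. a \<in> carrier R \<Longrightarrow> b \<in> carrier R \<Longrightarrow> c \<in> carrier R \<Longrightarrow> d \<in> carrier R \<Longrightarrow>
        F (a \<oplus> c) (b \<oplus> d) = F a b \<oplus>\<^bsub>V\<^esub> F c d"
    and smult: "\<And>r a b. r \<in> carrier R \<Longrightarrow> a \<in> carrier R \<Longrightarrow> b \<in> carrier R \<Longrightarrow>
        F (r \<otimes> a) (r \<otimes> b) = r \<odot>\<^bsub>V\<^esub> F a b"
    and wd: "\<And>a b c d. a \<in> carrier R \<Longrightarrow> b \<in> carrier R \<Longrightarrow> c \<in> carrier R \<Longrightarrow> d \<in> carrier R \<Longrightarrow>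
        a \<ominus> c \<in> I \<Longrightarrow> b \<ominus> d \<in> J \<Longrightarrow> F a b = F c d"
  shows "\<exists>f\<in>module_hom R W V. \<forall>a\<in>carrier R. \<forall>b\<in>carrier R. f (e a b) = F a b"
proof -
  note D = cyclic_sumD[OF C]
  obtain h k where hk: "\<And>w. w \<in> carrier W \<Longrightarrow> h w \<in> carrier R \<and> k w \<in> carrier R \<and> w = e (h w) (k w)"
    using D(5) by metis
  define f where "f = (\<lambda>w. F (h w) (k w))"
  have fe: "f (e a b) = F a b" if "a \<in> carrier R" "b \<in> carrier R" for a b
  proof -
    have "e (h (e a b)) (k (e a b)) = e a b" using hk[OF D(4)[OF that]] by simp
    then show ?thesis
      unfolding f_def using hk[OF D(4)[OF that]] that by (subst (asm) D(8)) (auto intro: wd)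
  qed
  have "f \<in> module_hom R W V"
    unfolding module_hom_def
  proof (intro CollectI conjI ballI)
    show "f \<in> carrier W \<rightarrow> carrier V" using hk F by (simp add: f_def)
    fix u v assume "u \<in> carrier W" "v \<in> carrier W"
    then obtain a b c d where *: "a \<in> carrier R" "b \<in> carrier R" "c \<in> carrier R" "d \<in> carrier R"
      "u = e a b" "v = e c d" using D(5) by meson
    then show "f (u \<oplus>\<^bsub>W\<^esub> v) = f u \<oplus>\<^bsub>V\<^esub> f v" by (simp add: D(6) fe add)
  next
    fix r u assume r: "r \<in> carrier R" and "u \<in> carrier W"
    then obtain a b where *: "a \<in> carrier R" "b \<in> carrier R" "u = e a b" using D(5) by meson
    then show "f (r \<odot>\<^bsub>W\<^esub> u) = r \<odot>\<^bsub>V\<^esub> f u" using r by (simp add: D(7) fe smult)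
  qed
  then show ?thesis using fe by blast
qed

text \<open>Project to a summand, reduce modulo a larger ideal, and include the result as the first
  summand of the target. Every map between cyclic sums in the main argument has one of these two
  forms.\<close>

lemma cyclic_sum_map:
  assumes C: "cyclic_sum R I J W e" and C': "cyclic_sum R I' J' W' e'"
  shows "I \<subseteq> I' \<Longrightarrow> \<exists>f\<in>module_hom R W W'. \<forall>a\<in>carrier R. \<forall>b\<in>carrier R. f (e a b) = e' a \<zero>"
    and "J \<subseteq> I' \<Longrightarrow> \<exists>f\<in>module_hom R W W'. \<forall>a\<in>carrier R. \<forall>b\<in>carrier R. f (e a b) = e' b \<zero>"
proof -
  note D' = cyclic_sumD[OF C']
  have z: "\<zero> \<ominus> \<zero> \<in> J'" using ideal_zero[OF D'(3)] by (simp add: a_minus_def)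
  show "\<exists>f\<in>module_hom R W W'. \<forall>a\<in>carrier R. \<forall>b\<in>carrier R. f (e a b) = e' a \<zero>" if "I \<subseteq> I'"
  proof (rule cyclic_sum_hom[OF C, of "\<lambda>a b. e' a \<zero>" W'])
    show "e' a \<zero> = e' c \<zero>" if "a \<in> carrier R" "c \<in> carrier R" "a \<ominus> c \<in> I" for a c
      using that \<open>I \<subseteq> I'\<close> z by (subst D'(8)) auto
  qed (simp_all add: D'(4,6,7))
  show "\<exists>f\<in>module_hom R W W'. \<forall>a\<in>carrier R. \<forall>b\<in>carrier R. f (e a b) = e' b \<zero>" if "J \<subseteq> I'"
  proof (rule cyclic_sum_hom[OF C, of "\<lambda>a b. e' b \<zero>" W'])
    show "e' b \<zero> = e' d \<zero>" if "b \<in> carrier R" "d \<in> carrier R" "b \<ominus> d \<in> J" for b d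
      using that \<open>J \<subseteq> I'\<close> z by (subst D'(8)) auto
  qed (simp_all add: D'(4,6,7))
qed

text \<open>\<open>R\<close> is treated as the degenerate sum of \<open>R/0\<close> and
  \<open>R/R\<close>, just as the residue field will be the sum of \<open>R/m\<close> and
  \<open>R/R\<close>, so that one construction supplies every module of the main argument.\<close>

lemma cyclic_sum_regular:
  assumes "cyclic_sum R {\<zero>} (carrier R) W e"
  shows "(\<lambda>a. e a \<zero>) \<in> module_iso R (regular_module R) W"
proof -
  note D = cyclic_sumD[OF assms]
  have inj: "a = c" if "a \<in> carrier R" "c \<in> carrier R" "e a \<zero> = e c \<zero>" for a c
    using that D(8)[of a \<zero> c \<zero>] by (simp add: r_right_minus_eq)
  have surj: "w \<in> (\<lambda>a. e a \<zero>) ` carrier R" if w: "w \<in> carrier W" for w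
  proof -
    obtain a b where ab: "a \<in> carrier R" "b \<in> carrier R" "w = e a b" using D(5)[OF w] by blast
    then have "e a b = e a \<zero>" by (simp add: D(8) a_minus_def r_neg)
    then show ?thesis using ab by auto
  qed
  show ?thesis
    unfolding module_iso_def module_hom_def bij_betw_def inj_on_def regular_module_def
    using inj surj by (auto simp: D(4,6,7))
qed

section \<open>Submodules and consequences of the Dietz axioms\<close>

lemma smult_submodule:
  assumes W: "module R W" and J: "ideal J R" and v: "v \<in> carrier W"
  shows "submodule {j \<odot>\<^bsub>W\<^esub> v | j. j \<in> J} R W"
proof -
  interpret W: module R W by (rule W)
  note Jc = ideal.Icarr[OF J]
  show ?thesis
  proof (rule W.submoduleI)
    show "{j \<odot>\<^bsub>W\<^esub> v | j. j \<in> J} \<subseteq> carrier W" using Jc v by auto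
    show "\<zero>\<^bsub>W\<^esub> \<in> {j \<odot>\<^bsub>W\<^esub> v | j. j \<in> J}" using ideal_zero[OF J] W.smult_l_null[OF v] by force
    fix a assume "a \<in> {j \<odot>\<^bsub>W\<^esub> v | j. j \<in> J}"
    then obtain j where j: "j \<in> J" "a = j \<odot>\<^bsub>W\<^esub> v" by blast
    have "\<ominus> j \<in> J" using j ideal.axioms(1)[OF J] by (simp add: additive_subgroup.a_inv_closed)
    moreover have "\<ominus>\<^bsub>W\<^esub> a = (\<ominus> j) \<odot>\<^bsub>W\<^esub> v" using j Jc v by (simp add: W.smult_l_minus)
    ultimately show "\<ominus>\<^bsub>W\<^esub> a \<in> {j \<odot>\<^bsub>W\<^esub> v | j. j \<in> J}" by blast
    fix b assume "b \<in> {j \<odot>\<^bsub>W\<^esub> v | j. j \<in> J}"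
    then obtain k where k: "k \<in> J" "b = k \<odot>\<^bsub>W\<^esub> v" by blast
    have "a \<oplus>\<^bsub>W\<^esub> b = (j \<oplus> k) \<odot>\<^bsub>W\<^esub> v" using j k Jc v by (simp add: W.smult_l_distr)
    then show "a \<oplus>\<^bsub>W\<^esub> b \<in> {j \<odot>\<^bsub>W\<^esub> v | j. j \<in> J}" using ideal_add[OF J j(1) k(1)] by blast
  next
    fix r a assume r: "r \<in> carrier R" and "a \<in> {j \<odot>\<^bsub>W\<^esub> v | j. j \<in> J}"
    then obtain j where j: "j \<in> J" "a = j \<odot>\<^bsub>W\<^esub> v" by blast
    have "r \<odot>\<^bsub>W\<^esub> a = (r \<otimes> j) \<odot>\<^bsub>W\<^esub> v" using j r Jc v by (simp add: W.smult_assoc1)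
    then show "r \<odot>\<^bsub>W\<^esub> a \<in> {j \<odot>\<^bsub>W\<^esub> v | j. j \<in> J}" using ideal.I_l_closed[OF J j(1) r] by blast
  qed
qed

lemma hom_image_submodule:
  assumes M: "module R M" and W: "module R W" and f: "f \<in> module_hom R M W" and N: "submodule N R M"
  shows "submodule (f ` N) R W"
proof -
  interpret M: module R M by (rule M)
  interpret W: module R W by (rule W)
  note Ns = M.submoduleE[OF N]
  have Nc: "x \<in> carrier M" if "x \<in> N" for x using Ns(1) that by blast
  have fc: "f x \<in> carrier W" if "x \<in> N" for x using f Nc[OF that] by (auto simp: module_hom_def)
  have fa: "f (x \<oplus>\<^bsub>M\<^esub> y) = f x \<oplus>\<^bsub>W\<^esub> f y" if "x \<in> N" "y \<in> N" for x y
    using f Nc that by (auto simp: module_hom_def)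
  have fs: "f (r \<odot>\<^bsub>M\<^esub> x) = r \<odot>\<^bsub>W\<^esub> f x" if "x \<in> N" "r \<in> carrier R" for x r
    using f Nc that by (auto simp: module_hom_def)
  have smult: "r \<odot>\<^bsub>W\<^esub> y \<in> f ` N" if "r \<in> carrier R" "y \<in> f ` N" for r y
    using that Ns(4) by (auto simp flip: fs)
  show ?thesis
  proof (rule W.submoduleI)
    show "f ` N \<subseteq> carrier W" using fc by blast
    obtain x where "x \<in> N" using Ns(2) by blast
    then show "\<zero>\<^bsub>W\<^esub> \<in> f ` N" using smult[OF zero_closed imageI, of x] W.smult_l_null[OF fc] by simp
    show "\<ominus>\<^bsub>W\<^esub> a \<in> f ` N" if "a \<in> f ` N" for a
    proof -
      have "(\<ominus> \<one>) \<odot>\<^bsub>W\<^esub> a = \<ominus>\<^bsub>W\<^esub> a" using that fc by (auto simp: W.smult_l_minus)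
      then show ?thesis using smult[OF _ that, of "\<ominus> \<one>"] by simp
    qed
    show "a \<oplus>\<^bsub>W\<^esub> b \<in> f ` N" if "a \<in> f ` N" "b \<in> f ` N" for a b
      using that fa Ns(5) by (auto simp flip: fa)
  qed (rule smult)
qed

text \<open>Functoriality followed by monotonicity: it is enough to know that the image of
  \<open>N\<close> lies in \<open>L\<close>.\<close>

lemma dietz_closure_hom:
  assumes cl: "dietz_closure R cl" and M: "fg_module R M" and W: "fg_module R W"
    and f: "f \<in> module_hom R M W" and N: "submodule N R M" and L: "submodule L R W"
    and sub: "\<And>x. x \<in> N \<Longrightarrow> f x \<in> L" and x: "x \<in> cl M N"
  shows "f x \<in> cl W L"
proof -
  have "f ` cl M N \<subseteq> cl W (f ` N)"
    using cl M W f N unfolding dietz_closure_def functorial_def by blast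
  moreover have "submodule (f ` N) R W"
    using hom_image_submodule M W f N by (auto simp: fg_module_def)
  then have "cl W (f ` N) \<subseteq> cl W L"
    using cl W L sub unfolding dietz_closure_def closure_operation_def by (meson image_subsetI)
  ultimately show ?thesis using x by blast
qed

text \<open>Generalized colon-capturing for \<open>f : R/(u) \<oplus> R/J \<rightarrow> R/(u)\<close> and \<open>v = (z, 1)\<close>, since
  \<open>(0, p) = p v - (z p, 0)\<close>.\<close>

lemma dietz_closure_colon:
  assumes cl: "dietz_closure R cl" and C: "cyclic_sum R (Idl {u}) J W e"
    and sop: "partial_system_of_parameters R [u, z]"
    and p: "p \<in> carrier R" and u: "u \<in> carrier R" and z: "z \<in> carrier R"
    and zp: "e (z \<otimes> p) \<zero> \<in> cl W {r \<odot>\<^bsub>W\<^esub> e z \<one> | r. r \<in> carrier R}"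
  shows "e \<zero> p \<in> cl W {j \<odot>\<^bsub>W\<^esub> e z \<one> | j. j \<in> Idl {u}}"
proof -
  note D = cyclic_sumD[OF C]
  note fg = cyclic_sum_fg[OF C]
  interpret W: module R W by (rule D)
  let ?I = "Idl {u}" and ?v = "e z \<one>"
  have v: "?v \<in> carrier W" using D(4) z by simp
  let ?Rv = "{r \<odot>\<^bsub>W\<^esub> ?v | r. r \<in> carrier R}"
  have Rv: "submodule ?Rv R W" by (rule smult_submodule[OF D(1) oneideal v])
  have clRv: "submodule (cl W ?Rv) R W" "?Rv \<subseteq> cl W ?Rv"
    using cl fg Rv unfolding dietz_closure_def closure_operation_def by blast+
  have "\<exists>f\<in>module_hom R W (quotient_module R ?I). \<forall>a\<in>carrier R. \<forall>b\<in>carrier R. f (e a b) = ?I +> a"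
  proof (rule cyclic_sum_hom[OF C, of "\<lambda>a b. ?I +> a" "quotient_module R ?I"])
    show "?I +> a \<in> carrier (quotient_module R ?I)" if "a \<in> carrier R" for a
      using that by (auto simp: quotient_module_def FactRing_def A_RCOSETS_def' )
    show "?I +> (a \<oplus> c) = (?I +> a) \<oplus>\<^bsub>quotient_module R ?I\<^esub> (?I +> c)"
      if "a \<in> carrier R" "c \<in> carrier R" for a c
      using that by (simp add: quotient_module_def FactRing_def ideal.a_rcos_sum[OF D(2)])
    show "?I +> (r \<otimes> a) = r \<odot>\<^bsub>quotient_module R ?I\<^esub> (?I +> a)"
      if "a \<in> carrier R" "r \<in> carrier R" for a r
      using that by (simp add: quotient_module_def ideal.rcoset_mult_add[OF D(2)])
    show "?I +> a = ?I +> c" if "a \<in> carrier R" "c \<in> carrier R" "a \<ominus> c \<in> ?I" for a c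
      using that quotient_eq_iff_same_a_r_cos[OF D(2)] by blast
  qed
  then obtain f where f: "f \<in> module_hom R W (quotient_module R ?I)"
    and fe: "\<And>a b. a \<in> carrier R \<Longrightarrow> b \<in> carrier R \<Longrightarrow> f (e a b) = ?I +> a" by blast
  have "f \<in> module_epi R W (quotient_module R ?I)"
    unfolding module_epi_def
  proof (intro CollectI conjI f)
    have "y \<in> f ` carrier W" if y: "y \<in> carrier (quotient_module R ?I)" for y
    proof -
      obtain a where a: "a \<in> carrier R" "y = ?I +> a"
        using y by (auto simp: quotient_module_def FactRing_def A_RCOSETS_def')
      then have "y = f (e a \<zero>)" "e a \<zero> \<in> carrier W" using fe D(4) by auto
      then show ?thesis by blast
    qed
    then show "f ` carrier W = carrier (quotient_module R ?I)" using f by (auto simp: module_hom_def)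
  qed
  moreover have "partial_system_of_parameters R ([u] @ [z])" using sop by simp
  moreover have "f ?v = ?I +> z" using fe[OF z one_closed] .
  moreover have "generalized_colon_capturing R cl" using cl by (simp add: dietz_closure_def)
  \<comment> \<open>The axiom for \<open>k = 1\<close>: the ideal is generated by \<open>u\<close>
    alone and the next parameter is \<open>z\<close>.\<close>
  note this[unfolded generalized_colon_capturing_def Let_def, rule_format, of "[u]" z W f ?v]
  ultimately have "cl W ?Rv \<inter> module_ker W (quotient_module R ?I) f
      \<subseteq> cl W {j \<odot>\<^bsub>W\<^esub> ?v | j. j \<in> ?I}"
    using fg v by (simp only: list.set)
  moreover have "e \<zero> p \<in> cl W ?Rv"
  proof -
    have "p \<odot>\<^bsub>W\<^esub> ?v \<in> cl W ?Rv" using clRv(2) p by blast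
    moreover have "(\<ominus> \<one>) \<odot>\<^bsub>W\<^esub> e (z \<otimes> p) \<zero> \<in> cl W ?Rv"
      using W.submoduleE(4)[OF clRv(1) _ zp] by simp
    ultimately have "p \<odot>\<^bsub>W\<^esub> ?v \<oplus>\<^bsub>W\<^esub> (\<ominus> \<one>) \<odot>\<^bsub>W\<^esub> e (z \<otimes> p) \<zero> \<in> cl W ?Rv"
      by (rule W.submoduleE(5)[OF clRv(1)])
    moreover have "p \<odot>\<^bsub>W\<^esub> ?v \<oplus>\<^bsub>W\<^esub> (\<ominus> \<one>) \<odot>\<^bsub>W\<^esub> e (z \<otimes> p) \<zero> = e \<zero> p"
      using p z by (simp add: D(6,7) l_minus r_neg m_comm[of p z])
    ultimately show ?thesis by simp
  qed
  moreover have "e \<zero> p \<in> module_ker W (quotient_module R ?I) f"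
    using fe[of \<zero> p] D(4)[of \<zero> p] p a_rcos_zero[OF D(2) ideal_zero[OF D(2)]]
    by (simp add: module_ker_def quotient_module_def FactRing_def)
  ultimately show ?thesis by blast
qed

end

context noetherian_local_ring
begin

text \<open>All that will be used of integral closure is one membership in a copy \<open>A\<close>
  of \<open>R\<close>, so a single contradiction serves the liftable closure and every other
  extension alike. The two partial systems come in the order of the cancellations: \<open>x\<close>
  modulo \<open>y^2\<close>, then \<open>y\<close> modulo \<open>x\<close>.\<close>

lemma dietz_closure_product:
  fixes cl :: "('a, 'c) module \<Rightarrow> 'c set \<Rightarrow> 'c set"
  assumes cl: "dietz_closure R cl" and large: "large_universe R TYPE('c)"
    and x: "x \<in> \<mm>" and y: "y \<in> \<mm>"
    and sop: "partial_system_of_parameters R [y \<otimes> y, x]" "partial_system_of_parameters R [x, y]"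
    and A: "cyclic_sum R {\<zero>} (carrier R) A eA"
  shows "eA (x \<otimes> y) \<zero> \<notin> cl A ((\<lambda>a. eA a \<zero>) ` (Idl {x \<otimes> x, y \<otimes> y}))"
proof
  assume xy: "eA (x \<otimes> y) \<zero> \<in> cl A ((\<lambda>a. eA a \<zero>) ` (Idl {x \<otimes> x, y \<otimes> y}))"
  have c: "x \<in> carrier R" "y \<in> carrier R" using x y ideal.Icarr[OF max_ideal_ideal] by auto
  have ideals: "ideal (Idl {y \<otimes> y}) R" "ideal (Idl {x}) R" "ideal (Idl {y}) R"
    "ideal (Idl {x \<otimes> x, y \<otimes> y}) R" using c by (auto intro!: genideal_ideal)
  have Idl: "\<exists>r\<in>carrier R. j = r \<otimes> a" if "j \<in> Idl {a}" "a \<in> carrier R" for j a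
    using that by (auto simp: cgenideal_eq_genideal[symmetric] cgenideal_def)
  obtain B :: "('a, 'c) module" and eB where B: "cyclic_sum R (Idl {y \<otimes> y}) (Idl {x}) B eB"
    using cyclic_sum_exists[OF ideals(1,2) large] .
  obtain C :: "('a, 'c) module" and eC where C: "cyclic_sum R (Idl {x}) (Idl {y}) C eC"
    using cyclic_sum_exists[OF ideals(2,3) large] .
  obtain K :: "('a, 'c) module" and eK where K: "cyclic_sum R \<mm> (carrier R) K eK"
    using cyclic_sum_exists[OF max_ideal_ideal oneideal large] .
  note AD = cyclic_sumD[OF A] and BD = cyclic_sumD[OF B] and CD = cyclic_sumD[OF C] and KD = cyclic_sumD[OF K]
  note fg = cyclic_sum_fg[OF A] cyclic_sum_fg[OF B] cyclic_sum_fg[OF C] cyclic_sum_fg[OF K]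
  have vB: "eB x \<one> \<in> carrier B" and vC: "eC y \<one> \<in> carrier C" using BD(4) CD(4) c by simp_all

  have iso: "(\<lambda>a. eA a \<zero>) \<in> module_iso R (regular_module R) A" by (rule cyclic_sum_regular[OF A])
  have sub: "submodule ((\<lambda>a. eA a \<zero>) ` I) R A" if I: "ideal I R" for I
  proof -
    have "(\<lambda>a. eA a \<zero>) ` I = {j \<odot>\<^bsub>A\<^esub> eA \<one> \<zero> | j. j \<in> I}"
      using ideal.Icarr[OF I] by (force simp: AD(7))
    then show ?thesis using smult_submodule[OF AD(1) I AD(4)[OF one_closed zero_closed]] by simp
  qed

  obtain g where g: "g \<in> module_hom R A B" "\<forall>a\<in>carrier R. \<forall>b\<in>carrier R. g (eA a b) = eB a \<zero>"
    using cyclic_sum_map(1)[OF A B] ideal_zero[OF ideals(1)] by blast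
  \<comment> \<open>\<open>g\<close> sends \<open>r x^2 + s y^2\<close> to the class
    \<open>(r x^2, 0)\<close>, which is \<open>r x\<close> times \<open>(x, 1)\<close> because
    \<open>x\<close> vanishes in the second summand.\<close>
  have "g (eA (x \<otimes> y) \<zero>) \<in> cl B {r \<odot>\<^bsub>B\<^esub> eB x \<one> | r. r \<in> carrier R}"
  proof (rule dietz_closure_hom[OF cl fg(1,2) g(1) sub[OF ideals(4)] smult_submodule[OF BD(1) oneideal vB] _ xy])
    fix w assume "w \<in> (\<lambda>a. eA a \<zero>) ` (Idl {x \<otimes> x, y \<otimes> y})"
    then obtain a where a: "a \<in> Idl {x \<otimes> x, y \<otimes> y}" "w = eA a \<zero>" by blast
    have xx: "ideal (Idl {x \<otimes> x}) R" "y \<otimes> y \<in> carrier R" using c by (auto intro!: genideal_ideal)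
    have "Idl {x \<otimes> x, y \<otimes> y} \<subseteq> adjoin R (Idl {x \<otimes> x}) (y \<otimes> y)"
      using adjoin_superset[OF xx] adjoin_self[OF xx] genideal_self'[of "x \<otimes> x"] c
      by (intro genideal_minimal adjoin_ideal xx) auto
    then obtain i s where ia: "i \<in> Idl {x \<otimes> x}" "s \<in> carrier R" "a = i \<oplus> s \<otimes> (y \<otimes> y)"
      using a(1) unfolding adjoin_def by blast
    obtain r where r: "r \<in> carrier R" "i = r \<otimes> (x \<otimes> x)" using Idl[OF ia(1)] c by blast
    have "(r \<otimes> (x \<otimes> x) \<oplus> s \<otimes> (y \<otimes> y)) \<ominus> (r \<otimes> x) \<otimes> x = s \<otimes> (y \<otimes> y)"
      using r ia c by algebra
    moreover have "s \<otimes> (y \<otimes> y) \<in> Idl {y \<otimes> y}"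
      using ideal.I_l_closed[OF ideals(1) genideal_self'] ia c by simp
    moreover have "\<zero> \<ominus> (r \<otimes> x) \<otimes> \<one> \<in> Idl {x}"
    proof -
      have "\<zero> \<ominus> (r \<otimes> x) \<otimes> \<one> = (\<ominus> r) \<otimes> x" using r c by algebra
      then show ?thesis using ideal.I_l_closed[OF ideals(2) genideal_self', of "\<ominus> r"] r c by simp
    qed
    ultimately have "eB a \<zero> = (r \<otimes> x) \<odot>\<^bsub>B\<^esub> eB x \<one>"
      using r ia c by (simp add: BD(7,8))
    moreover have "g w = eB a \<zero>" using g(2) a r ia c by simp
    ultimately show "g w \<in> {r \<odot>\<^bsub>B\<^esub> eB x \<one> | r. r \<in> carrier R}"
      using m_closed[OF r(1) c(1)] by auto
  qed
  then have "eB (x \<otimes> y) \<zero> \<in> cl B {r \<odot>\<^bsub>B\<^esub> eB x \<one> | r. r \<in> carrier R}" using g(2) c by simp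
  then have yB: "eB \<zero> y \<in> cl B {j \<odot>\<^bsub>B\<^esub> eB x \<one> | j. j \<in> Idl {y \<otimes> y}}"
    using dietz_closure_colon[OF cl B sop(1)] c by simp

  obtain h where h: "h \<in> module_hom R B C" "\<forall>a\<in>carrier R. \<forall>b\<in>carrier R. h (eB a b) = eC b \<zero>"
    using cyclic_sum_map(2)[OF B C] by blast
  \<comment> \<open>The image of \<open>r y^2\<close> times \<open>(x, 1)\<close> is the class
    \<open>(r y^2, 0)\<close>, which is \<open>r y\<close> times \<open>(y, 1)\<close> because
    \<open>y\<close> vanishes in the second summand of \<open>C\<close>.\<close>
  have "h (eB \<zero> y) \<in> cl C {r \<odot>\<^bsub>C\<^esub> eC y \<one> | r. r \<in> carrier R}"
  proof (rule dietz_closure_hom[OF cl fg(2,3) h(1) smult_submodule[OF BD(1) ideals(1) vB]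
        smult_submodule[OF CD(1) oneideal vC] _ yB])
    fix w assume "w \<in> {j \<odot>\<^bsub>B\<^esub> eB x \<one> | j. j \<in> Idl {y \<otimes> y}}"
    then obtain r where r: "r \<in> carrier R" "w = (r \<otimes> (y \<otimes> y)) \<odot>\<^bsub>B\<^esub> eB x \<one>"
      using Idl[of _ "y \<otimes> y"] c by blast
    have "h w = eC (r \<otimes> (y \<otimes> y)) \<zero>" using h(2) r c by (simp add: BD(7))
    also have "\<dots> = (r \<otimes> y) \<odot>\<^bsub>C\<^esub> eC y \<one>"
    proof -
      have "r \<otimes> (y \<otimes> y) \<ominus> (r \<otimes> y) \<otimes> y = \<zero>" "\<zero> \<ominus> (r \<otimes> y) \<otimes> \<one> = (\<ominus> r) \<otimes> y"
        using r(1) c(2) by algebra+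
      then have "r \<otimes> (y \<otimes> y) \<ominus> (r \<otimes> y) \<otimes> y \<in> Idl {x}" "\<zero> \<ominus> (r \<otimes> y) \<otimes> \<one> \<in> Idl {y}"
        using ideal.I_l_closed[OF ideals(3) genideal_self', of "\<ominus> r"] ideal_zero[OF ideals(2)] r(1) c
        by (simp_all only: a_inv_closed)
      then have "eC (r \<otimes> (y \<otimes> y)) \<zero> = eC ((r \<otimes> y) \<otimes> y) ((r \<otimes> y) \<otimes> \<one>)"
        by (subst CD(8)) (use r(1) c in simp_all)
      then show ?thesis using r(1) c by (simp only: CD(7) m_closed one_closed)
    qed
    finally show "h w \<in> {r \<odot>\<^bsub>C\<^esub> eC y \<one> | r. r \<in> carrier R}"
      using m_closed[OF r(1) c(2)] by auto
  qed
  \<comment> \<open>The factor \<open>\<one>\<close> is written out to match the colon lemma with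
    \<open>p = \<one>\<close>.\<close>
  then have "eC (y \<otimes> \<one>) \<zero> \<in> cl C {r \<odot>\<^bsub>C\<^esub> eC y \<one> | r. r \<in> carrier R}" using h(2) c by simp
  then have oneC: "eC \<zero> \<one> \<in> cl C {j \<odot>\<^bsub>C\<^esub> eC y \<one> | j. j \<in> Idl {x}}"
    using dietz_closure_colon[OF cl C sop(2)] c by simp

  obtain k where k: "k \<in> module_hom R C K" "\<forall>a\<in>carrier R. \<forall>b\<in>carrier R. k (eC a b) = eK b \<zero>"
    using cyclic_sum_map(2)[OF C K] genideal_minimal[OF max_ideal_ideal, of "{y}"] y by blast
  interpret K: module R K by (rule KD)
  have zero_sub: "submodule {\<zero>\<^bsub>K\<^esub>} R K" by (rule K.submoduleI) auto
  have zeroK: "eK j \<zero> = \<zero>\<^bsub>K\<^esub> \<longleftrightarrow> j \<in> \<mm>" if "j \<in> carrier R" for j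
    using that cyclic_sum_zero[OF K] KD(8)[of j \<zero> \<zero> \<zero>] by (simp add: a_minus_def)
  \<comment> \<open>\<open>K\<close> is the residue field. A multiple \<open>j v\<close> with
    \<open>j\<close> in \<open>(x)\<close> has second entry \<open>j\<close>, which lies in the
    maximal ideal and so becomes zero.\<close>
  have "k (eC \<zero> \<one>) \<in> cl K {\<zero>\<^bsub>K\<^esub>}"
  proof (rule dietz_closure_hom[OF cl fg(3,4) k(1) smult_submodule[OF CD(1) ideals(2) vC] zero_sub _ oneC])
    fix w assume "w \<in> {j \<odot>\<^bsub>C\<^esub> eC y \<one> | j. j \<in> Idl {x}}"
    then obtain j where j: "j \<in> Idl {x}" "w = j \<odot>\<^bsub>C\<^esub> eC y \<one>" by blast
    have jm: "j \<in> \<mm>" using j(1) genideal_minimal[OF max_ideal_ideal, of "{x}"] x by blast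
    then have jc: "j \<in> carrier R" using ideal.Icarr[OF max_ideal_ideal] by blast
    have "k w = eK j \<zero>" using k(2) j jc c by (simp add: CD(7))
    then show "k w \<in> {\<zero>\<^bsub>K\<^esub>}" using zeroK[OF jc] jm by simp
  qed
  \<comment> \<open>\<open>K\<close> is the quotient of the copy \<open>A\<close> of
    \<open>R\<close> by the maximal ideal, which is closed by faithfulness, so semi-residuality
    applies.\<close>
  moreover have "cl K {\<zero>\<^bsub>K\<^esub>} = {\<zero>\<^bsub>K\<^esub>}"
  proof -
    obtain p where p: "p \<in> module_hom R A K" "\<forall>a\<in>carrier R. \<forall>b\<in>carrier R. p (eA a b) = eK a \<zero>"
      using cyclic_sum_map(1)[OF A K] ideal_zero[OF max_ideal_ideal] by blast
    have surjA: "\<exists>a\<in>carrier R. w = eA a \<zero>" if "w \<in> carrier A" for w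
      using iso that unfolding module_iso_def bij_betw_def regular_module_def by auto
    have surjK: "\<exists>a\<in>carrier R. w = eK a \<zero>" if w: "w \<in> carrier K" for w
    proof -
      obtain a b where ab: "a \<in> carrier R" "b \<in> carrier R" "w = eK a b" using KD(5)[OF w] by blast
      then have "eK a b = eK a \<zero>"
        using ideal_zero[OF max_ideal_ideal] by (simp add: KD(8) a_minus_def r_neg)
      then show ?thesis using ab by auto
    qed
    have epi: "p \<in> module_epi R A K"
      unfolding module_epi_def
    proof (intro CollectI conjI p(1))
      have "w \<in> p ` carrier A" if "w \<in> carrier K" for w
        using surjK[OF that] p(2) AD(4) zero_closed by (metis imageI)
      then show "p ` carrier A = carrier K" using p(1) by (auto simp: module_hom_def)
    qed
    have ker: "module_ker A K p = (\<lambda>a. eA a \<zero>) ` \<mm>"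
    proof (intro equalityI subsetI)
      fix w assume "w \<in> module_ker A K p"
      then have w: "w \<in> carrier A" "p w = \<zero>\<^bsub>K\<^esub>" by (auto simp: module_ker_def)
      obtain a where "a \<in> carrier R" "w = eA a \<zero>" using surjA[OF w(1)] by blast
      then show "w \<in> (\<lambda>a. eA a \<zero>) ` \<mm>" using w(2) p(2) zeroK by auto
    next
      fix w assume "w \<in> (\<lambda>a. eA a \<zero>) ` \<mm>"
      then obtain a where a: "a \<in> \<mm>" "w = eA a \<zero>" by blast
      then have "a \<in> carrier R" using ideal.Icarr[OF max_ideal_ideal] by blast
      then show "w \<in> module_ker A K p" using a p(2) zeroK AD(4) by (simp add: module_ker_def)
    qed
    have "cl A ((\<lambda>a. eA a \<zero>) ` \<mm>) = (\<lambda>a. eA a \<zero>) ` \<mm>"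
      using cl fg(1) iso unfolding dietz_closure_def faithful_closure_def max_ideal_eq by blast
    then show ?thesis
      using cl fg(1,4) sub[OF max_ideal_ideal] epi ker
      unfolding dietz_closure_def semi_residual_def by blast
  qed
  ultimately have "\<one> \<in> \<mm>" using k(2) zeroK[OF one_closed] by simp
  then show False using prime_one_notin[OF max_ideal_prime] by blast
qed

end


section \<open>Integral closure\<close>

context cring
begin

lemma product_mem_ideal_integral_closure:
  assumes x: "x \<in> carrier R" and y: "y \<in> carrier R"
  shows "x \<otimes> y \<in> ideal_integral_closure R (Idl {x \<otimes> x, y \<otimes> y})"
proof -
  let ?I = "Idl {x \<otimes> x, y \<otimes> y}"
  \<comment> \<open>\<open>ideal_power\<close> is a nested product ending in the whole ring,
    \<open>I (I R)\<close> for exponent 2 and \<open>I R\<close> for exponent 1. The coefficients,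
    zero included, are written with factors in that pattern.\<close>
  define a where "a = (\<lambda>i::nat. if i = 2 then (x \<otimes> x) \<otimes> ((y \<otimes> y) \<otimes> \<ominus> \<one>) else (x \<otimes> x) \<otimes> \<zero>)"
  have I: "x \<otimes> x \<in> ?I" "y \<otimes> y \<in> ?I" using genideal_self[of "{x \<otimes> x, y \<otimes> y}"] x y by auto
  have "a 1 \<in> ideal_power R ?I 1" "a 2 \<in> ideal_power R ?I 2"
    unfolding a_def ideal_power_def using I by (auto simp: numeral_2_eq_2 intro!: ideal_prod.prod)
  moreover have two: "{1..2} = {1, 2::nat}" by auto
  ultimately have "\<forall>i\<in>{1..2}. a i \<in> ideal_power R ?I i" by simp
  moreover have "(x \<otimes> y) [^] (2::nat) \<oplus> (\<Oplus>i\<in>{1..2}. a i \<otimes> (x \<otimes> y) [^] (2 - i)) = \<zero>"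
  proof -
    have "(x \<otimes> y) \<otimes> (x \<otimes> y) \<oplus> (x \<otimes> x) \<otimes> ((y \<otimes> y) \<otimes> \<ominus> \<one>) = \<zero>" using x y by algebra
    then show ?thesis using x y unfolding two by (simp add: a_def numeral_2_eq_2)
  qed
  ultimately show ?thesis
    unfolding ideal_integral_closure_def integral_equation_def using x y
    by (intro CollectI conjI m_closed exI[of _ 2] exI[of _ a]) simp_all
qed

section \<open>Integral equations in the symmetric algebra in one variable\<close>

text \<open>\<open>monomial c n\<close> is the polynomial \<open>c X\<^sub>0\<^sup>n\<close>.\<close>

definition monomial :: "'a \<Rightarrow> nat \<Rightarrow> nat multiset \<Rightarrow> 'a" where
  "monomial c n = (\<lambda>m. if m = replicate_mset n 0 then c else \<zero>)"

text \<open>This handles the finite sums in linear forms and integral equations; products and powers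
  are computed directly on monomials.\<close>

lemma sym_algebra_abelian_monoid: "abelian_monoid (sym_algebra R s)"
proof -
  have c: "P m \<in> carrier R" if "P \<in> indexed_pset {..<s} (carrier R)" for P :: "nat multiset \<Rightarrow> 'a" and m
    using indexed_pset_in_carrier[OF subset_refl that] by (rule carrier_coeffE)
  show ?thesis
  proof (rule abelian_monoidI)
    show "x \<oplus>\<^bsub>sym_algebra R s\<^esub> y \<oplus>\<^bsub>sym_algebra R s\<^esub> z = x \<oplus>\<^bsub>sym_algebra R s\<^esub> (y \<oplus>\<^bsub>sym_algebra R s\<^esub> z)"
      if "x \<in> carrier (sym_algebra R s)" "y \<in> carrier (sym_algebra R s)" "z \<in> carrier (sym_algebra R s)" for x y z
      using that by (simp add: sym_algebra_def indexed_padd_def c a_assoc)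
    show "x \<oplus>\<^bsub>sym_algebra R s\<^esub> y = y \<oplus>\<^bsub>sym_algebra R s\<^esub> x"
      if "x \<in> carrier (sym_algebra R s)" "y \<in> carrier (sym_algebra R s)" for x y
      using that by (simp add: sym_algebra_def indexed_padd_def c a_comm)
  qed (simp_all add: sym_algebra_def indexed_pset.intros indexed_padd_zero indexed_pset_in_carrier[OF subset_refl])
qed

lemma monomial_closed:
  assumes "c \<in> carrier R"
  shows "monomial c n \<in> carrier (sym_algebra R 1)"
proof (induction n)
  case 0
  have "monomial c 0 = indexed_const c" by (simp add: monomial_def indexed_const_def)
  then show ?case using assms by (simp add: sym_algebra_def indexed_pset.indexed_const)
next
  case (Suc n)
  have "m - {#0#} = replicate_mset n 0 \<longleftrightarrow> m = replicate_mset (Suc n) 0" if "0 \<in># m" for m :: "nat multiset"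
    using that by (auto dest: multi_member_split)
  then have "monomial c (Suc n) = indexed_pmult (monomial c n) 0"
    by (auto simp: monomial_def indexed_pmult_def)
  then show ?case using Suc indexed_pset.indexed_pmult[of "monomial c n" "{..<1}" "carrier R" 0]
    by (simp add: sym_algebra_def)
qed

lemma monomial_add: "c \<in> carrier R \<Longrightarrow> d \<in> carrier R \<Longrightarrow>
    monomial c n \<oplus>\<^bsub>sym_algebra R s\<^esub> monomial d n = monomial (c \<oplus> d) n"
  by (auto simp: sym_algebra_def indexed_padd_def monomial_def)

text \<open>Zero is a monomial of every degree, so the free \<open>n\<close> can be chosen to match
  the equation at hand.\<close>

lemma monomial_zero: "\<zero>\<^bsub>sym_algebra R s\<^esub> = monomial \<zero> n"
  by (auto simp: sym_algebra_def indexed_const_def monomial_def)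

lemma monomial_one: "\<one>\<^bsub>sym_algebra R s\<^esub> = monomial \<one> 0"
  by (auto simp: sym_algebra_def indexed_const_def monomial_def)

text \<open>In the convolution over the submultisets of \<open>m\<close>, only the summand that
  splits off \<open>j\<close> copies of the index \<open>0\<close> can be nonzero.\<close>

lemma monomial_mult:
  assumes c: "c \<in> carrier R" and d: "d \<in> carrier R"
  shows "monomial c j \<otimes>\<^bsub>sym_algebra R s\<^esub> monomial d k = monomial (c \<otimes> d) (j + k)"
proof
  fix m :: "nat multiset"
  have replicate_mset_plus: "replicate_mset (j + k) (0::nat) = replicate_mset j 0 + replicate_mset k 0"
    by (induction j) simp_all
  let ?j = "replicate_mset j (0::nat)"
  let ?A = "{l. l \<subseteq># m}"
  have fin: "finite ?A"
  proof (rule finite_subset)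
    show "?A \<subseteq> mset ` {ls. set ls \<subseteq> set_mset m \<and> length ls \<le> size m}"
    proof
      fix l assume l: "l \<in> ?A"
      obtain ls where "l = mset ls" using ex_mset[of l] by blast
      then show "l \<in> mset ` {ls. set ls \<subseteq> set_mset m \<and> length ls \<le> size m}"
        using l set_mset_mono[of l m] size_mset_mono[of l m] by auto
    qed
  qed (simp add: finite_lists_length_le)
  have eq: "m - ?j = replicate_mset k 0 \<longleftrightarrow> m = replicate_mset (j + k) 0" if "?j \<subseteq># m"
    using that by (metis add_diff_cancel_left' replicate_mset_plus subset_mset.add_diff_inverse)
  have "(monomial c j \<otimes>\<^bsub>sym_algebra R s\<^esub> monomial d k) m
      = (\<Oplus>l\<in>?A. monomial c j l \<otimes> monomial d k (m - l))"
    by (simp add: sym_algebra_def)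
  also have "\<dots> = (\<Oplus>l\<in>?A. if ?j = l then c \<otimes> monomial d k (m - l) else \<zero>)"
    using c d by (intro finsum_cong') (auto simp: monomial_def)
  also have "\<dots> = monomial (c \<otimes> d) (j + k) m"
  proof (cases "?j \<subseteq># m")
    case True
    then have "(\<Oplus>l\<in>?A. if ?j = l then c \<otimes> monomial d k (m - l) else \<zero>) = c \<otimes> monomial d k (m - ?j)"
      using fin c d by (intro finsum_singleton) (auto simp: monomial_def)
    also have "\<dots> = monomial (c \<otimes> d) (j + k) m" using eq[OF True] c by (simp add: monomial_def)
    finally show ?thesis .
  next
    case False
    then have "m \<noteq> replicate_mset (j + k) 0" by (auto simp: replicate_mset_plus)
    moreover have "(\<Oplus>l\<in>?A. if ?j = l then c \<otimes> monomial d k (m - l) else \<zero>) = (\<Oplus>l\<in>?A. \<zero>)"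
      using False by (intro finsum_cong') auto
    ultimately show ?thesis by (simp add: monomial_def)
  qed
  finally show "(monomial c j \<otimes>\<^bsub>sym_algebra R s\<^esub> monomial d k) m = monomial (c \<otimes> d) (j + k) m" .
qed

lemma linear_form_monomial:
  assumes "v 0 \<in> carrier R"
  shows "linear_form R 1 v = monomial (v 0) 1"
proof -
  interpret S: abelian_monoid "sym_algebra R 1" by (rule sym_algebra_abelian_monoid)
  have "m - {#0#} = {#} \<longleftrightarrow> m = {#0#}" if "0 \<in># m" for m :: "nat multiset"
    using that by (auto dest: multi_member_split)
  then have "indexed_pmult (indexed_const (v 0)) 0 = monomial (v 0) 1"
    by (auto simp: indexed_pmult_def indexed_const_def monomial_def)
  moreover have "{..<1} = {0::nat}" by auto
  ultimately show ?thesis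
    unfolding linear_form_def using monomial_closed[OF assms, of 1]
    by (simp del: One_nat_def)
qed

text \<open>With \<open>z = x y X\<close> the relation is \<open>z^2 - (x^2 X) (y^2 X) = 0\<close>.
  Its constant coefficient is a product of \<open>-1\<close> and two linear forms from
  \<open>G\<close>, hence lies in the subring; the coefficient of \<open>z\<close> is zero.\<close>

lemma product_mem_integral_closure_in:
  assumes x: "x \<in> carrier R" and y: "y \<in> carrier R"
    and G: "(\<lambda>i\<in>{..<1}. x \<otimes> x) \<in> G" "(\<lambda>i\<in>{..<1}. y \<otimes> y) \<in> G"
  shows "linear_form R 1 (\<lambda>i\<in>{..<1}. x \<otimes> y) \<in> integral_closure_in (sym_algebra R 1) (rees_subring R 1 G)"
proof -
  let ?S = "sym_algebra R 1" and ?T = "rees_subring R 1 G"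
  interpret S: abelian_monoid ?S by (rule sym_algebra_abelian_monoid)
  define z where "z = monomial (x \<otimes> y) 1"
  have z: "linear_form R 1 (\<lambda>i\<in>{..<1}. x \<otimes> y) = z"
    unfolding z_def using x y by (subst linear_form_monomial) simp_all
  have const: "monomial c 0 \<in> ?T" if "c \<in> carrier R" for c
  proof -
    have "monomial c 0 = indexed_const c" by (simp add: monomial_def indexed_const_def)
    then show ?thesis unfolding rees_subring_def using that by (auto intro: generate_ring.incl)
  qed
  have lin: "monomial c 1 \<in> ?T" if "c \<in> carrier R" "(\<lambda>i\<in>{..<1}. c) \<in> G" for c
  proof -
    have "linear_form R 1 (\<lambda>i\<in>{..<1}. c) = monomial c 1"
      using that(1) by (subst linear_form_monomial) simp_all
    then show ?thesis unfolding rees_subring_def using that(2) by (metis UnI2 generate_ring.incl imageI)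
  qed
  define a where "a = (\<lambda>i::nat. if i = 2
    then monomial (\<ominus> \<one>) 0 \<otimes>\<^bsub>?S\<^esub> (monomial (x \<otimes> x) 1 \<otimes>\<^bsub>?S\<^esub> monomial (y \<otimes> y) 1) else monomial \<zero> 0)"
  have a: "a 1 = monomial \<zero> 0" "a 2 = monomial (\<ominus> ((x \<otimes> x) \<otimes> (y \<otimes> y))) 2"
    unfolding a_def using x y by (simp_all add: monomial_mult l_minus numeral_2_eq_2)
  have "a i \<in> ?T" for i
  proof -
    have "monomial (\<ominus> \<one>) 0 \<otimes>\<^bsub>?S\<^esub> (monomial (x \<otimes> x) 1 \<otimes>\<^bsub>?S\<^esub> monomial (y \<otimes> y) 1) \<in> ?T"
      using const[of "\<ominus> \<one>"] lin[of "x \<otimes> x"] lin[of "y \<otimes> y"] x y G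
      unfolding rees_subring_def by (intro generate_ring.eng_mult) auto
    then show ?thesis using const[of \<zero>] by (simp add: a_def)
  qed
  moreover have "z [^]\<^bsub>?S\<^esub> (2::nat) \<oplus>\<^bsub>?S\<^esub> (\<Oplus>\<^bsub>?S\<^esub>i\<in>{1..2}. a i \<otimes>\<^bsub>?S\<^esub> z [^]\<^bsub>?S\<^esub> (2 - i)) = \<zero>\<^bsub>?S\<^esub>"
  proof -
    have pow: "z [^]\<^bsub>?S\<^esub> (0::nat) = monomial \<one> 0" "z [^]\<^bsub>?S\<^esub> (1::nat) = monomial (x \<otimes> y) 1"
      "z [^]\<^bsub>?S\<^esub> (2::nat) = monomial ((x \<otimes> y) \<otimes> (x \<otimes> y)) 2"
      unfolding z_def numeral_2_eq_2 using x y by (simp_all add: nat_pow_def monomial_one monomial_mult)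
    have t: "a 1 \<otimes>\<^bsub>?S\<^esub> z [^]\<^bsub>?S\<^esub> (1::nat) = \<zero>\<^bsub>?S\<^esub>"
      "a 2 \<otimes>\<^bsub>?S\<^esub> z [^]\<^bsub>?S\<^esub> (0::nat) = monomial (\<ominus> ((x \<otimes> x) \<otimes> (y \<otimes> y))) 2"
      unfolding a pow using x y by (simp_all add: monomial_mult monomial_zero[of "Suc 0" "Suc 0"])
    have "{1..2} = {1, 2::nat}" by auto
    then have sum2: "(\<Oplus>\<^bsub>?S\<^esub>i\<in>{1..2}. g i) = g 1 \<oplus>\<^bsub>?S\<^esub> g 2"
      if "g 1 \<in> carrier ?S" "g 2 \<in> carrier ?S" for g :: "nat \<Rightarrow> nat multiset \<Rightarrow> 'a"
      using that by (simp del: One_nat_def)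
    define g where "g = (\<lambda>i. a i \<otimes>\<^bsub>?S\<^esub> z [^]\<^bsub>?S\<^esub> (2 - i))"
    have g: "g 1 = \<zero>\<^bsub>?S\<^esub>" "g 2 = monomial (\<ominus> ((x \<otimes> x) \<otimes> (y \<otimes> y))) 2"
      using t by (simp_all add: g_def)
    have "(\<Oplus>\<^bsub>?S\<^esub>i\<in>{1..2}. g i) = monomial (\<ominus> ((x \<otimes> x) \<otimes> (y \<otimes> y))) 2"
      using x y by (subst sum2) (simp_all only: g S.zero_closed S.l_zero monomial_closed m_closed a_inv_closed)
    then have "(\<Oplus>\<^bsub>?S\<^esub>i\<in>{1..2}. a i \<otimes>\<^bsub>?S\<^esub> z [^]\<^bsub>?S\<^esub> (2 - i)) = monomial (\<ominus> ((x \<otimes> x) \<otimes> (y \<otimes> y))) 2"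
      by (simp only: g_def)
    moreover have "(x \<otimes> y) \<otimes> (x \<otimes> y) \<oplus> \<ominus> ((x \<otimes> x) \<otimes> (y \<otimes> y)) = \<zero>" using x y by algebra
    ultimately show ?thesis
      unfolding pow using x y by (simp add: monomial_add monomial_zero[of "Suc 0" 2])
  qed
  moreover have "z \<in> carrier ?S" unfolding z_def using x y by (intro monomial_closed) simp
  ultimately show ?thesis
    unfolding z integral_closure_in_def integral_equation_def
    by (intro CollectI conjI exI[of _ 2] exI[of _ a]) auto
qed

text \<open>The union over all surjections allows a convenient choice: the copy \<open>M\<close> of
  \<open>R\<close> is covered by the free module of rank 1 through \<open>f\<close>, and one
  variable suffices.\<close>

lemma product_mem_liftable_integral_closure:
  assumes x: "x \<in> carrier R" and y: "y \<in> carrier R"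
    and f: "f \<in> module_iso R (regular_module R) M"
  shows "f (x \<otimes> y) \<in> liftable_integral_closure R M (f ` (Idl {x \<otimes> x, y \<otimes> y}))"
proof -
  let ?I = "Idl {x \<otimes> x, y \<otimes> y}"
  define p where "p = (\<lambda>v :: nat \<Rightarrow> 'a. f (v 0))"
  define c where "c = (\<lambda>a :: 'a. \<lambda>i\<in>{..<1::nat}. a)"
  have I: "x \<otimes> x \<in> ?I" "y \<otimes> y \<in> ?I" using genideal_self[of "{x \<otimes> x, y \<otimes> y}"] x y by auto
  have c: "c a \<in> carrier (free_module R 1)" "p (c a) = f a" if "a \<in> carrier R" for a
    using that by (auto simp: c_def p_def free_module_def)
  have zero: "v 0 \<in> carrier R" if "v \<in> carrier (free_module R 1)" for v
    using that by (auto simp: free_module_def)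
  have "p \<in> module_hom R (free_module R 1) M"
    using f zero unfolding module_iso_def module_hom_def p_def
    by (auto simp: free_module_def regular_module_def)
  moreover have "p ` carrier (free_module R 1) = carrier M"
  proof -
    have "f ` carrier R = carrier M"
      using f by (auto simp: module_iso_def bij_betw_def regular_module_def)
    moreover have "p ` carrier (free_module R 1) = f ` carrier R"
    proof (intro equalityI subsetI)
      fix w assume "w \<in> f ` carrier R"
      then obtain a where "a \<in> carrier R" "w = f a" by blast
      then have "c a \<in> carrier (free_module R 1)" "w = p (c a)" using c by simp_all
      then show "w \<in> p ` carrier (free_module R 1)" by blast
    qed (use zero in \<open>auto simp: p_def\<close>)
    ultimately show ?thesis by simp
  qed
  ultimately have "p \<in> module_epi R (free_module R 1) M" by (simp add: module_epi_def)
  moreover have "c (x \<otimes> y) \<in> free_integral_closure R 1 {v \<in> carrier (free_module R 1). p v \<in> f ` ?I}"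
    unfolding free_integral_closure_def
    using c[of "x \<otimes> x"] c[of "y \<otimes> y"] c[of "x \<otimes> y"] I x y
      product_mem_integral_closure_in[OF x y, of "{v \<in> carrier (free_module R 1). p v \<in> f ` ?I}"]
    by (simp add: c_def)
  ultimately show ?thesis
    unfolding liftable_integral_closure_def c(2)[OF m_closed[OF x y], symmetric] by blast
qed

end

theorem corollary6p2:
  fixes R :: "('a, 'm) ring_scheme"
  assumes "local_domain R"
    and "krull_dim R \<ge> 2"
    and "large_universe R TYPE('b)"
  shows "\<not> dietz_closure R (liftable_integral_closure R :: ('a, 'b) module \<Rightarrow> 'b set \<Rightarrow> 'b set) \<and>
         (\<forall>cl :: ('a, 'b) module \<Rightarrow> 'b set \<Rightarrow> 'b set.
            extends_integral_closure R cl \<longrightarrow> \<not> dietz_closure R cl)"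
proof -
  interpret noetherian_domain R using assms(1) by (simp add: local_domain_def)
  have "\<exists>!m. maximalideal m R" using assms(1) by (simp add: local_domain_def)
  then obtain m where m: "maximalideal m R" "\<And>P. maximalideal P R \<Longrightarrow> P = m" by blast
  interpret noetherian_local_ring R m
    by (intro noetherian_local_ring.intro noetherian_cring.intro noetherian_local_ring_axioms.intro
        noetherian_ring_axioms is_cring m)
  obtain xs where xs: "set xs \<subseteq> m" "enat (length xs) = krull_dim R"
    "\<And>P. primeideal P R \<Longrightarrow> set xs \<subseteq> P \<Longrightarrow> P = m"
    using exists_parameters by blast
  have "enat 2 \<le> enat (length xs)" using assms(2) xs(2) by (simp add: numeral_eq_enat)
  then obtain x y zs where xyz: "xs = x # y # zs" by (cases xs; cases "tl xs") auto
  have xm: "x \<in> m" and ym: "y \<in> m" using xs(1) xyz by auto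
  have x: "x \<in> carrier R" and y: "y \<in> carrier R" using xm ym ideal.Icarr[OF max_ideal_ideal] by auto
  have sop1: "partial_system_of_parameters R [x, y]"
    unfolding partial_system_of_parameters_def
    using system_of_parametersI[OF xs] xyz by (intro exI[of _ zs]) simp
  \<comment> \<open>A prime that contains \<open>y^2\<close> contains \<open>y\<close>, so the new
    list lies in no further prime.\<close>
  have "system_of_parameters R ([y \<otimes>\<^bsub>R\<^esub> y, x] @ zs)"
  proof (rule system_of_parametersI)
    show "set ([y \<otimes>\<^bsub>R\<^esub> y, x] @ zs) \<subseteq> m"
      using xs(1) xyz ideal.I_l_closed[OF max_ideal_ideal ym y] by auto
    show "enat (length ([y \<otimes>\<^bsub>R\<^esub> y, x] @ zs)) = krull_dim R" using xs(2) xyz by simp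
    fix P assume P: "primeideal P R" "set ([y \<otimes>\<^bsub>R\<^esub> y, x] @ zs) \<subseteq> P"
    then have "y \<in> P" using primeideal.I_prime[OF P(1) y y] by auto
    then show "P = m" using xs(3)[OF P(1)] P(2) xyz by auto
  qed
  then have sop2: "partial_system_of_parameters R [y \<otimes>\<^bsub>R\<^esub> y, x]"
    unfolding partial_system_of_parameters_def by blast
  obtain A :: "('a, 'b) module" and e where A: "cyclic_sum R {\<zero>\<^bsub>R\<^esub>} (carrier R) A e"
    using cyclic_sum_exists[OF zeroideal oneideal assms(3)] .
  let ?f = "\<lambda>a. e a \<zero>\<^bsub>R\<^esub>"
  let ?I = "Idl\<^bsub>R\<^esub> {x \<otimes>\<^bsub>R\<^esub> x, y \<otimes>\<^bsub>R\<^esub> y}"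
  have f: "?f \<in> module_iso R (regular_module R) A" by (rule cyclic_sum_regular[OF A])
  have not_dietz: "\<not> dietz_closure R cl"
    if "?f (x \<otimes>\<^bsub>R\<^esub> y) \<in> cl A (?f ` ?I)" for cl :: "('a, 'b) module \<Rightarrow> 'b set \<Rightarrow> 'b set"
    using dietz_closure_product[OF _ assms(3) xm ym sop2 sop1 A] that by blast
  have "\<not> dietz_closure R (liftable_integral_closure R :: ('a, 'b) module \<Rightarrow> 'b set \<Rightarrow> 'b set)"
    by (rule not_dietz) (rule product_mem_liftable_integral_closure[OF x y f])
  moreover have "\<not> dietz_closure R cl" if cl: "extends_integral_closure R cl"
    for cl :: "('a, 'b) module \<Rightarrow> 'b set \<Rightarrow> 'b set"
  proof (rule not_dietz)
    have "ideal ?I R" using x y by (intro genideal_ideal) auto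
    then have "cl A (?f ` ?I) = ?f ` ideal_integral_closure R ?I"
      using cl f cyclic_sum_fg[OF A] unfolding extends_integral_closure_def by blast
    then show "?f (x \<otimes>\<^bsub>R\<^esub> y) \<in> cl A (?f ` ?I)"
      using product_mem_ideal_integral_closure[OF x y] by blast
  qed
  ultimately show ?thesis by blast
qed

end
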